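(* Let $K,d\ge 0$ be integers. Let $V$ be a torsion-free FI-module generated in degree $\le d$ satisfying $I_{K+1}\cdot V=0$. Then for all $n>K+d$ and any $a\le n$ (with $n,a\in\mathbb{N}$), $$V_{[n]-\{1\}}+\cdots+V_{[n]-\{a\}}=\ker\widetilde{J}_{[a]}$$ as subgroups of $V_n$, where $\widetilde{J}_{[a]}$ is regarded as a homomorphism $V_{[n]}\to V_{[n]\sqcup[\star_a]}$.
   Context: $\mathrm{FI}$ is the category of finite sets and injections. An FI-module is a functor $W\colon \mathrm{FI}\to \mathbb{Z}\text{-Mod}$; write $W_T=W(T)$, $[n]=\{1,\dots,n\}$, $W_n=W_{[n]}$, and $f_*\colon W_S\to W_T$ for the map induced by an injection $f$; elements of $\mathbb{Z}[\mathrm{Hom}_{\mathrm{FI}}(S,T)]$ act as homomorphisms $W_S\to W_T$ by linear extension. Degree: $\deg W=\inf\{k\in\{-\infty\}\cup\mathbb{N}\cup\{\infty\}\mid W_n=0\text{ for all }n\in\mathbb{N}\text{ with }n>k\}$. Define $H_0(W)_T=W_T/\operatorname{span}(\operatorname{im} f_*\colon W_S\to W_T\mid f\colon S\hookrightarrow T,\ |S|<|T|)$. $W$ is generated in degree $\le m$ if $\deg H_0(W)\le m$. $W$ is torsion-free if all maps $f_*$ are injective; then for $S\subset T$, $W_S$ is identified with its image in $W_T$ under the map induced by inclusion. For distinct $i,j$ in a finite set, $J^i_j=\mathrm{id}-(i\ j)$ in the integral group ring of the symmetric group on that set, where $(i\ j)$ is the transposition. For $m\in\mathbb{N}$, $I_m\subset\mathbb{Z}[S_n]$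 is the two-sided ideal generated by all products $J^{i_1}_{j_1}J^{i_2}_{j_2}\cdots J^{i_m}_{j_m}$ where $i_1,j_1,\dots,i_m,j_m$ are $2m$ distinct elements of $[n]$ (so $I_m=0$ if $2m>n$). The condition $I_m\cdot V=0$ means $I_m\cdot V_n=0$ for all $n\ge 0$. $[\star_a]=\{\star_1,\dots,\star_a\}$ is a fixed $a$-element set, $\iota\colon[n]\hookrightarrow[n]\sqcup[\star_a]$ is the standard inclusion, and $$\widetilde{J}_{[a]}=J_1^{\star_1}J_2^{\star_2}\cdots J_a^{\star_a}\circ\iota\in\mathbb{Z}[\mathrm{Hom}_{\mathrm{FI}}([n],[n]\sqcup[\star_a])].$$ *)

theory Defs
  imports
    "HOL-Library.Extended_Real"
    "HOL-Combinatorics.Transposition"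
    "HOL-Algebra.IntRing"
    "HOL-Algebra.Generated_Groups"
    "HOL-Algebra.Module"
begin

text \<open>
  FI is represented by its full subcategory on the finite subsets of \<^typ>\<open>nat\<close>, which is
  equivalent to the category of all finite sets and injections. Morphisms are extensional
  functions, so that equality of morphisms is equality of HOL functions.
\<close>

definition fi_hom :: "nat set \<Rightarrow> nat set \<Rightarrow> (nat \<Rightarrow> nat) set" where
  "fi_hom S T = {f \<in> S \<rightarrow>\<^sub>E T. inj_on f S}"

definition fi_incl :: "nat set \<Rightarrow> nat \<Rightarrow> nat" where
  "fi_incl S = (\<lambda>x\<in>S. x)"

definition module_hom ::
  "('r, 'm) ring_scheme \<Rightarrow> ('r, 'a) module \<Rightarrow> ('r, 'b) module \<Rightarrow> ('a \<Rightarrow> 'b) set" where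
  "module_hom R M N = {h \<in> carrier M \<rightarrow> carrier N.
     (\<forall>x\<in>carrier M. \<forall>y\<in>carrier M. h (x \<oplus>\<^bsub>M\<^esub> y) = h x \<oplus>\<^bsub>N\<^esub> h y) \<and>
     (\<forall>c\<in>carrier R. \<forall>x\<in>carrier M. h (c \<odot>\<^bsub>M\<^esub> x) = c \<odot>\<^bsub>N\<^esub> h x)}"

text \<open>
  The map induced by \<open>f \<in> fi_hom S T\<close> is \<open>F S T f\<close>; the codomain \<open>T\<close> has to be passed
  explicitly because it cannot be recovered from \<open>f\<close>. In the module records the
  fields \<^const>\<open>monoid.mult\<close> and \<^const>\<open>one\<close> play no role.
\<close>

locale FI_module =
  fixes V :: "nat set \<Rightarrow> (int, 'a) module"
    and F :: "nat set \<Rightarrow> nat set \<Rightarrow> (nat \<Rightarrow> nat) \<Rightarrow> 'a \<Rightarrow> 'a"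
  assumes obj_module: "finite T \<Longrightarrow> module \<Z> (V T)"
    and map_hom: "finite S \<Longrightarrow> finite T \<Longrightarrow> f \<in> fi_hom S T \<Longrightarrow>
      F S T f \<in> module_hom \<Z> (V S) (V T)"
    and map_id: "finite T \<Longrightarrow> v \<in> carrier (V T) \<Longrightarrow> F T T (fi_incl T) v = v"
    and map_comp: "finite S \<Longrightarrow> finite T \<Longrightarrow> finite U \<Longrightarrow> f \<in> fi_hom S T \<Longrightarrow> g \<in> fi_hom T U \<Longrightarrow>
      v \<in> carrier (V S) \<Longrightarrow> F S U (compose S g f) v = F T U g (F S T f v)"

definition torsion_free ::
  "(nat set \<Rightarrow> (int, 'a) module) \<Rightarrow> (nat set \<Rightarrow> nat set \<Rightarrow> (nat \<Rightarrow> nat) \<Rightarrow> 'a \<Rightarrow> 'a) \<Rightarrow> bool" where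
  "torsion_free V F \<longleftrightarrow>
     (\<forall>S T. finite S \<longrightarrow> finite T \<longrightarrow> (\<forall>f\<in>fi_hom S T. inj_on (F S T f) (carrier (V S))))"


subsection \<open>Degree and generation\<close>

text \<open>The degree depends only on the modules, not on the induced maps.\<close>

definition fi_degree :: "(nat set \<Rightarrow> (int, 'a) module) \<Rightarrow> ereal" where
  "fi_degree W = Inf {k. k \<in> {-\<infinity>, \<infinity>} \<union> range (\<lambda>m::nat. ereal (real m)) \<and>
     (\<forall>n::nat. ereal (real n) > k \<longrightarrow> carrier (W {1..n}) = {\<zero>\<^bsub>W {1..n}\<^esub>})}"

definition quot_module :: "('r, 'a) module \<Rightarrow> 'a set \<Rightarrow> ('r, 'a set) module" where
  "quot_module M N = \<lparr>carrier = a_rcosets\<^bsub>M\<^esub> N, monoid.mult = (\<lambda>_ _. N), one = N,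
     zero = N, add = (<+>\<^bsub>M\<^esub>), smult = (\<lambda>c A. N <+>\<^bsub>M\<^esub> (\<lambda>x. c \<odot>\<^bsub>M\<^esub> x) ` A)\<rparr>"

text \<open>The integral span of a subset is the additive subgroup generated by it.\<close>

definition lower_span ::
  "(nat set \<Rightarrow> (int, 'a) module) \<Rightarrow> (nat set \<Rightarrow> nat set \<Rightarrow> (nat \<Rightarrow> nat) \<Rightarrow> 'a \<Rightarrow> 'a)
    \<Rightarrow> nat set \<Rightarrow> 'a set" where
  "lower_span V F T = generate (add_monoid (V T))
     (\<Union>S\<in>{S. finite S \<and> card S < card T}. \<Union>f\<in>fi_hom S T. F S T f ` carrier (V S))"

definition H0 ::
  "(nat set \<Rightarrow> (int, 'a) module) \<Rightarrow> (nat set \<Rightarrow> nat set \<Rightarrow> (nat \<Rightarrow> nat) \<Rightarrow> 'a \<Rightarrow> 'a)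
    \<Rightarrow> nat set \<Rightarrow> (int, 'a set) module" where
  "H0 V F T = quot_module (V T) (lower_span V F T)"

definition generated_in_degree_le ::
  "(nat set \<Rightarrow> (int, 'a) module) \<Rightarrow> (nat set \<Rightarrow> nat set \<Rightarrow> (nat \<Rightarrow> nat) \<Rightarrow> 'a \<Rightarrow> 'a)
    \<Rightarrow> nat \<Rightarrow> bool" where
  "generated_in_degree_le V F m \<longleftrightarrow> fi_degree (H0 V F) \<le> ereal (real m)"


subsection \<open>Formal integral combinations of injections\<close>

text \<open>
  An element of the free abelian group on \<open>fi_hom S T\<close> is an integer-valued function vanishing
  off \<open>fi_hom S T\<close> (a finite set whenever \<open>S\<close> and \<open>T\<close> are finite).
\<close>

definition zhom :: "nat set \<Rightarrow> nat set \<Rightarrow> ((nat \<Rightarrow> nat) \<Rightarrow> int) set" where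
  "zhom S T = {x. \<forall>f. f \<notin> fi_hom S T \<longrightarrow> x f = 0}"

definition zsingle :: "(nat \<Rightarrow> nat) \<Rightarrow> (nat \<Rightarrow> nat) \<Rightarrow> int" where
  "zsingle f = (\<lambda>g. if g = f then 1 else 0)"

definition zcomp :: "nat set \<Rightarrow> nat set \<Rightarrow> nat set \<Rightarrow>
    ((nat \<Rightarrow> nat) \<Rightarrow> int) \<Rightarrow> ((nat \<Rightarrow> nat) \<Rightarrow> int) \<Rightarrow> (nat \<Rightarrow> nat) \<Rightarrow> int" where
  "zcomp S T U y x = (\<lambda>h. \<Sum>(g, f)\<in>{(g, f) \<in> fi_hom T U \<times> fi_hom S T. compose S g f = h}. y g * x f)"

definition zact ::
  "(nat set \<Rightarrow> (int, 'a) module) \<Rightarrow> (nat set \<Rightarrow> nat set \<Rightarrow> (nat \<Rightarrow> nat) \<Rightarrow> 'a \<Rightarrow> 'a)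
    \<Rightarrow> nat set \<Rightarrow> nat set \<Rightarrow> ((nat \<Rightarrow> nat) \<Rightarrow> int) \<Rightarrow> 'a \<Rightarrow> 'a" where
  "zact V F S T x v = (\<Oplus>\<^bsub>V T\<^esub>f\<in>fi_hom S T. x f \<odot>\<^bsub>V T\<^esub> F S T f v)"

text \<open>
  Injective self-maps of a finite set are permutations, so \<open>zgroup_ring T\<close> is the integral group
  ring of the symmetric group on \<open>T\<close>.
\<close>

definition zgroup_ring :: "nat set \<Rightarrow> ((nat \<Rightarrow> nat) \<Rightarrow> int) ring" where
  "zgroup_ring T = \<lparr>carrier = zhom T T, monoid.mult = zcomp T T T, one = zsingle (fi_incl T),
     zero = (\<lambda>_. 0), add = (\<lambda>x y f. x f + y f)\<rparr>"

definition J_elt :: "nat set \<Rightarrow> nat \<Rightarrow> nat \<Rightarrow> (nat \<Rightarrow> nat) \<Rightarrow> int" where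
  "J_elt T i j = (\<lambda>f. zsingle (fi_incl T) f - zsingle (restrict (transpose i j) T) f)"

definition J_prod :: "nat set \<Rightarrow> (nat \<times> nat) list \<Rightarrow> (nat \<Rightarrow> nat) \<Rightarrow> int" where
  "J_prod T ps = foldr (\<otimes>\<^bsub>zgroup_ring T\<^esub>) (map (\<lambda>(i, j). J_elt T i j) ps) \<one>\<^bsub>zgroup_ring T\<^esub>"

definition I_ideal :: "nat \<Rightarrow> nat \<Rightarrow> ((nat \<Rightarrow> nat) \<Rightarrow> int) set" where
  "I_ideal m n = Idl\<^bsub>zgroup_ring {1..n}\<^esub> {J_prod {1..n} (zip is js) | is js.
     length is = m \<and> length js = m \<and> distinct (is @ js) \<and> set (is @ js) \<subseteq> {1..n}}"

definition I_annihilates ::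
  "nat \<Rightarrow> (nat set \<Rightarrow> (int, 'a) module) \<Rightarrow> (nat set \<Rightarrow> nat set \<Rightarrow> (nat \<Rightarrow> nat) \<Rightarrow> 'a \<Rightarrow> 'a)
    \<Rightarrow> bool" where
  "I_annihilates m V F \<longleftrightarrow> (\<forall>n. \<forall>x\<in>I_ideal m n. \<forall>v\<in>carrier (V {1..n}).
     zact V F {1..n} {1..n} x v = \<zero>\<^bsub>V {1..n}\<^esub>)"

text \<open>
  The disjoint union of \<open>{1..n}\<close> and an \<open>a\<close>-element set is \<open>{1..n} \<union> star ` {1..a}\<close>, where
  \<open>star\<close> is injective on \<open>{1..a}\<close> with values outside \<open>{1..n}\<close>.
\<close>

definition J_tilde :: "nat \<Rightarrow> nat \<Rightarrow> (nat \<Rightarrow> nat) \<Rightarrow> (nat \<Rightarrow> nat) \<Rightarrow> int" where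
  "J_tilde n a star = (let T = {1..n} \<union> star ` {1..a} in
     zcomp {1..n} T T (J_prod T (map (\<lambda>k. (star k, k)) [1..<Suc a])) (zsingle (fi_incl {1..n})))"

text \<open>For torsion-free \<open>V\<close> and \<open>S \<subseteq> T\<close>, the copy of \<open>V S\<close> inside \<open>V T\<close>.\<close>

definition sub_image ::
  "(nat set \<Rightarrow> (int, 'a) module) \<Rightarrow> (nat set \<Rightarrow> nat set \<Rightarrow> (nat \<Rightarrow> nat) \<Rightarrow> 'a \<Rightarrow> 'a)
    \<Rightarrow> nat set \<Rightarrow> nat set \<Rightarrow> 'a set" where
  "sub_image V F S T = F S T (fi_incl S) ` carrier (V S)"

definition deletion_sum ::
  "(nat set \<Rightarrow> (int, 'a) module) \<Rightarrow> (nat set \<Rightarrow> nat set \<Rightarrow> (nat \<Rightarrow> nat) \<Rightarrow> 'a \<Rightarrow> 'a)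
    \<Rightarrow> nat \<Rightarrow> nat \<Rightarrow> 'a set" where
  "deletion_sum V F n a = foldr (<+>\<^bsub>V {1..n}\<^esub>)
     (map (\<lambda>k. sub_image V F ({1..n} - {k}) {1..n}) [1..<Suc a]) {\<zero>\<^bsub>V {1..n}\<^esub>}"


subsection \<open>Well-definedness\<close>

lemma finite_fi_hom: "finite S \<Longrightarrow> finite T \<Longrightarrow> finite (fi_hom S T)"
  unfolding fi_hom_def by (rule finite_subset[OF _ finite_PiE[of S "\<lambda>_. T"]]) auto

lemma fi_incl_in: "S \<subseteq> T \<Longrightarrow> fi_incl S \<in> fi_hom S T"
  by (auto simp: fi_hom_def fi_incl_def inj_on_def)

lemma fi_transpose_in: "i \<in> T \<Longrightarrow> j \<in> T \<Longrightarrow> restrict (transpose i j) T \<in> fi_hom T T"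
  by (auto simp: fi_hom_def inj_on_def transpose_eq_iff transpose_def)

lemma fi_compose_in: "f \<in> fi_hom S T \<Longrightarrow> g \<in> fi_hom T U \<Longrightarrow> compose S g f \<in> fi_hom S U"
  by (auto simp: fi_hom_def inj_on_def compose_def Pi_iff PiE_def)

lemma fi_compose_assoc:
  "f \<in> fi_hom S T \<Longrightarrow> g \<in> fi_hom T U \<Longrightarrow> compose S (compose T h g) f = compose S h (compose S g f)"
  by (auto simp: fi_hom_def compose_def fun_eq_iff)

lemma fi_compose_id_left: "f \<in> fi_hom S T \<Longrightarrow> compose S (fi_incl T) f = f"
  by (auto simp: fi_hom_def compose_def fi_incl_def fun_eq_iff PiE_def extensional_def)

lemma fi_compose_id_right: "g \<in> fi_hom S T \<Longrightarrow> compose S g (fi_incl S) = g"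
  by (auto simp: fi_hom_def compose_def fi_incl_def fun_eq_iff PiE_def extensional_def)

lemma zcomp_in: "zcomp S T U y x \<in> zhom S U"
proof -
  have "zcomp S T U y x h = 0" if "h \<notin> fi_hom S U" for h
  proof -
    have "{(g, f) \<in> fi_hom T U \<times> fi_hom S T. compose S g f = h} = {}"
      using that fi_compose_in by blast
    then show ?thesis by (simp only: zcomp_def sum.empty)
  qed
  then show ?thesis by (simp add: zhom_def)
qed

lemma zcomp_eq_if:
  assumes "finite S" "finite T" "finite U"
  shows "zcomp S T U y x h =
    (\<Sum>g\<in>fi_hom T U. \<Sum>f\<in>fi_hom S T. if compose S g f = h then y g * x f else 0)"
proof -
  have fin: "finite (fi_hom T U \<times> fi_hom S T)"
    using assms by (simp add: finite_fi_hom)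
  have "zcomp S T U y x h =
    (\<Sum>p\<in>{p \<in> fi_hom T U \<times> fi_hom S T. compose S (fst p) (snd p) = h}. y (fst p) * x (snd p))"
    unfolding zcomp_def by (rule sum.cong) auto
  also have "\<dots> = (\<Sum>p\<in>fi_hom T U \<times> fi_hom S T.
      if compose S (fst p) (snd p) = h then y (fst p) * x (snd p) else 0)"
    by (rule sum.inter_filter[OF fin])
  finally show ?thesis by (simp add: sum.cartesian_product case_prod_beta)
qed

lemma zcomp_assoc:
  assumes fin: "finite S" "finite T" "finite U" "finite W"
  shows "zcomp S U W z (zcomp S T U y x) = zcomp S T W (zcomp T U W z y) x"
proof
  fix k
  let ?A = "fi_hom S T" and ?B = "fi_hom T U" and ?C = "fi_hom U W"
  have fins: "finite ?A" "finite ?B" "finite ?C" "finite (fi_hom S U)" "finite (fi_hom T W)"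
    using fin by (auto intro: finite_fi_hom)
  have "zcomp S U W z (zcomp S T U y x) k = (\<Sum>h\<in>?C. \<Sum>e\<in>fi_hom S U. \<Sum>g\<in>?B. \<Sum>f\<in>?A.
      if compose S g f = e then (if compose S h e = k then z h * (y g * x f) else 0) else 0)"
    using fin by (auto simp: zcomp_eq_if sum_distrib_left intro!: sum.cong sum.neutral)
  also have "\<dots> = (\<Sum>h\<in>?C. \<Sum>g\<in>?B. \<Sum>f\<in>?A. \<Sum>e\<in>fi_hom S U.
      if compose S g f = e then (if compose S h e = k then z h * (y g * x f) else 0) else 0)"
    by (rule sum.cong[OF refl], subst sum.swap, rule sum.cong[OF refl], rule sum.swap)
  also have "\<dots> = (\<Sum>h\<in>?C. \<Sum>g\<in>?B. \<Sum>f\<in>?A.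
      if compose S h (compose S g f) = k then z h * (y g * x f) else 0)"
    using fins fi_compose_in by (intro sum.cong refl) (subst sum.delta', auto)
  also have "\<dots> = (\<Sum>h\<in>?C. \<Sum>g\<in>?B. \<Sum>f\<in>?A. \<Sum>e\<in>fi_hom T W.
      if compose T h g = e then (if compose S e f = k then z h * (y g * x f) else 0) else 0)"
    using fins fi_compose_in
    by (intro sum.cong refl) (subst sum.delta', auto simp: fi_compose_assoc)
  also have "\<dots> = (\<Sum>h\<in>?C. \<Sum>g\<in>?B. \<Sum>e\<in>fi_hom T W. \<Sum>f\<in>?A.
      if compose T h g = e then (if compose S e f = k then z h * (y g * x f) else 0) else 0)"
    by (rule sum.cong[OF refl], rule sum.cong[OF refl], rule sum.swap)
  also have "\<dots> = (\<Sum>h\<in>?C. \<Sum>e\<in>fi_hom T W. \<Sum>g\<in>?B. \<Sum>f\<in>?A.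
      if compose T h g = e then (if compose S e f = k then z h * (y g * x f) else 0) else 0)"
    by (rule sum.cong[OF refl], rule sum.swap)
  also have "\<dots> = (\<Sum>e\<in>fi_hom T W. \<Sum>h\<in>?C. \<Sum>g\<in>?B. \<Sum>f\<in>?A.
      if compose T h g = e then (if compose S e f = k then z h * (y g * x f) else 0) else 0)"
    by (rule sum.swap)
  also have "\<dots> = (\<Sum>e\<in>fi_hom T W. \<Sum>f\<in>?A. \<Sum>h\<in>?C. \<Sum>g\<in>?B.
      if compose T h g = e then (if compose S e f = k then z h * (y g * x f) else 0) else 0)"
    by (rule sum.cong[OF refl], rule trans[OF _ sum.swap], rule sum.cong[OF refl], rule sum.swap)
  also have "\<dots> = zcomp S T W (zcomp T U W z y) x k"
    using fin by (auto simp: zcomp_eq_if sum_distrib_right mult.assoc intro!: sum.cong sum.neutral)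
  finally show "zcomp S U W z (zcomp S T U y x) k = zcomp S T W (zcomp T U W z y) x k" .
qed

lemma zcomp_id_left:
  assumes "finite S" "finite T" "x \<in> zhom S T"
  shows "zcomp S T T (zsingle (fi_incl T)) x = x"
proof
  fix h
  have "zcomp S T T (zsingle (fi_incl T)) x h =
    (\<Sum>g\<in>fi_hom T T. if g = fi_incl T then (\<Sum>f\<in>fi_hom S T. if f = h then x f else 0) else 0)"
    using assms by (auto simp: zcomp_eq_if zsingle_def fi_compose_id_left intro!: sum.cong sum.neutral)
  also have "\<dots> = x h"
    using assms by (simp add: finite_fi_hom fi_incl_in zhom_def)
  finally show "zcomp S T T (zsingle (fi_incl T)) x h = x h" .
qed

lemma zcomp_id_right:
  assumes "finite S" "finite T" "x \<in> zhom S T"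
  shows "zcomp S S T x (zsingle (fi_incl S)) = x"
proof
  fix h
  have "zcomp S S T x (zsingle (fi_incl S)) h =
    (\<Sum>g\<in>fi_hom S T. \<Sum>f\<in>fi_hom S S. if f = fi_incl S then (if g = h then x g else 0) else 0)"
    using assms by (auto simp: zcomp_eq_if zsingle_def fi_compose_id_right intro!: sum.cong)
  also have "\<dots> = x h"
    using assms by (simp add: finite_fi_hom fi_incl_in zhom_def)
  finally show "zcomp S S T x (zsingle (fi_incl S)) h = x h" .
qed

lemma zsingle_in: "f \<in> fi_hom S T \<Longrightarrow> zsingle f \<in> zhom S T"
  by (auto simp: zsingle_def zhom_def)

lemma J_elt_in: "i \<in> T \<Longrightarrow> j \<in> T \<Longrightarrow> J_elt T i j \<in> zhom T T"
  using zsingle_in[OF fi_incl_in[of T T]] zsingle_in[OF fi_transpose_in[of i T j]]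
  by (auto simp: J_elt_def zhom_def)

lemma zcomp_add_left:
  "zcomp S T U (\<lambda>g. y g + y' g) x = (\<lambda>h. zcomp S T U y x h + zcomp S T U y' x h)"
  by (simp add: zcomp_def case_prod_beta distrib_right sum.distrib)

lemma zcomp_add_right:
  "zcomp S T U y (\<lambda>f. x f + x' f) = (\<lambda>h. zcomp S T U y x h + zcomp S T U y x' h)"
  by (simp add: zcomp_def case_prod_beta distrib_left sum.distrib)

lemma ring_zgroup_ring:
  assumes "finite T"
  shows "ring (zgroup_ring T)"
proof (rule ringI)
  show "abelian_group (zgroup_ring T)"
  proof (rule abelian_groupI)
    fix x assume "x \<in> carrier (zgroup_ring T)"
    then show "\<exists>y\<in>carrier (zgroup_ring T). y \<oplus>\<^bsub>zgroup_ring T\<^esub> x = \<zero>\<^bsub>zgroup_ring T\<^esub>"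
      by (intro bexI[of _ "\<lambda>f. - x f"]) (auto simp: zgroup_ring_def zhom_def)
  qed (auto simp: zgroup_ring_def zhom_def)
  show "monoid (zgroup_ring T)"
    using assms
    by unfold_locales
      (auto simp: zgroup_ring_def zcomp_in zcomp_assoc zcomp_id_left zcomp_id_right
        zsingle_in fi_incl_in)
qed (simp_all add: zgroup_ring_def zcomp_add_left zcomp_add_right)

lemma J_prod_in:
  assumes "finite T" "\<forall>(i, j)\<in>set ps. i \<in> T \<and> j \<in> T"
  shows "J_prod T ps \<in> zhom T T"
  using assms(2)
  by (induction ps) (auto simp: J_prod_def zgroup_ring_def zcomp_in zsingle_in fi_incl_in)

lemma ideal_I_ideal: "ideal (I_ideal m n) (zgroup_ring {1..n})"
proof -
  interpret ring "zgroup_ring {1..n}" by (simp add: ring_zgroup_ring)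
  have "J_prod {1..n} (zip is js) \<in> carrier (zgroup_ring {1..n})"
    if "set (is @ js) \<subseteq> {1..n}" for "is" js
  proof -
    have "\<forall>(i, j)\<in>set (zip is js). i \<in> {1..n} \<and> j \<in> {1..n}"
    proof clarify
      fix i j assume "(i, j) \<in> set (zip is js)"
      then have "i \<in> set is" "j \<in> set js" by (auto dest: set_zip_leftD set_zip_rightD)
      with that show "i \<in> {1..n} \<and> j \<in> {1..n}" by (simp only: set_append Un_subset_iff) blast
    qed
    from J_prod_in[OF finite_atLeastAtMost this] show ?thesis
      by (simp only: zgroup_ring_def partial_object.simps)
  qed
  then show ?thesis unfolding I_ideal_def by (intro genideal_ideal subsetI) (elim CollectE exE conjE, simp)
qed

lemma J_tilde_in: "J_tilde n a star \<in> zhom {1..n} ({1..n} \<union> star ` {1..a})"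
  by (simp add: J_tilde_def Let_def zcomp_in)

end

theory Submission
  imports Defs
begin

text \<open>
  Every \<open>V\<^sub>T\<close> is realised inside one large group \<open>V\<^sub>U\<close>, on which the transpositions of \<open>U\<close> act.

  The claim is proved by induction on \<open>K\<close>. For \<open>a \<in> [n]\<close> and a label \<open>s\<close> outside \<open>[n]\<close>, the subgroups
  \<open>W\<^sub>T = J\<^sub>a\<^sup>s V\<^bsub>T \<union> {a}\<^esub>\<close> form a system of the same kind on \<open>U - {a, s}\<close>; it is annihilated by
  products of one factor fewer, and it is generated in degree \<open>\<le> d - 1\<close> because \<open>J\<^sub>a\<^sup>s\<close> kills \<open>V\<^sub>T\<close>. The
  claim for \<open>W\<close> in rank \<open>n - 1\<close> reduces the claim for \<open>V\<close> to the case of a single factor \<open>J\<^sub>x\<^sup>s\<close>.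

  For a single factor, expanding a vanishing product of \<open>K + 1\<close> factors shows that \<open>V\<^sub>n\<close> is the sum of the
  \<open>V\<^bsub>[n] - {b}\<^esub>\<close> over any \<open>K + 1\<close> values of \<open>b\<close>, one of which may be taken to be \<open>x\<close>. The other
  summands are then removed one at a time from an element of the kernel, by applying the claim for \<open>W\<close>
  in ranks \<open>n - 1\<close> and \<open>n - 2\<close>.
\<close>

subsection \<open>Spans and endomorphisms of abelian groups\<close>

context abelian_group
begin

definition aspan :: "'a set \<Rightarrow> 'a set" where
  "aspan X = generate (add_monoid G) X"

lemma aspan_subgroup: "X \<subseteq> carrier G \<Longrightarrow> additive_subgroup (aspan X) G"
  unfolding aspan_def
  by (rule additive_subgroupI) (rule group.generate_is_subgroup[OF a_group], simp)

lemma aspan_incl: "X \<subseteq> aspan X"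
  unfolding aspan_def by (auto intro: generate.incl)

lemma aspan_least:
  assumes "additive_subgroup H G" "X \<subseteq> H"
  shows "aspan X \<subseteq> H"
  unfolding aspan_def
  by (rule group.generate_subgroup_incl[OF a_group assms(2)])
    (rule additive_subgroup.a_subgroup[OF assms(1)])

lemma aspan_mono: "X \<subseteq> Y \<Longrightarrow> aspan X \<subseteq> aspan Y"
  unfolding aspan_def by (rule group.mono_generate[OF a_group])

lemma additive_subgroup_diffI:
  assumes "H \<subseteq> carrier G" "\<zero> \<in> H" "\<And>x y. x \<in> H \<Longrightarrow> y \<in> H \<Longrightarrow> x \<ominus> y \<in> H"
  shows "additive_subgroup H G"
proof -
  have neg: "\<ominus> x \<in> H" if "x \<in> H" for x
  proof -
    have "\<zero> \<ominus> x \<in> H" using assms that by blast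
    then show ?thesis using assms(1) that by (auto simp: minus_eq)
  qed
  have add: "x \<oplus> y \<in> H" if "x \<in> H" "y \<in> H" for x y
  proof -
    have "x \<ominus> (\<ominus> y) \<in> H" using assms(3) neg that by blast
    then show ?thesis using assms(1) that by (auto simp: minus_eq subset_iff)
  qed
  show ?thesis
    using assms(1,2) neg add by unfold_locales (auto simp: a_inv_def[symmetric])
qed

lemma additive_subgroup_minus:
  assumes "additive_subgroup H G" "x \<in> H" "y \<in> H"
  shows "x \<ominus> y \<in> H"
  using assms by (simp add: minus_eq additive_subgroup.a_closed
      additive_subgroup.a_inv_closed abelian_group_axioms)

lemma minus_eq_zero_iff:
  assumes "x \<in> carrier G" "y \<in> carrier G"
  shows "x \<ominus> y = \<zero> \<longleftrightarrow> x = y"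
proof
  assume "x \<ominus> y = \<zero>"
  then have "x \<oplus> \<ominus> y = \<zero>" by (simp add: minus_eq)
  from minus_equality[OF this] show "x = y" using assms by simp
qed (use assms in \<open>simp add: minus_eq r_neg\<close>)

lemma plus_minus_cancel:
  assumes "x \<in> carrier G" "y \<in> carrier G"
  shows "x \<oplus> (y \<ominus> x) = y"
proof -
  have "x \<oplus> (y \<ominus> x) = (x \<oplus> \<ominus> x) \<oplus> y" using assms by (simp only: minus_eq a_ac a_inv_closed)
  then show ?thesis using assms by (simp add: r_neg)
qed

lemma additive_subgroup_zero: "additive_subgroup {\<zero>} G"
  by (rule additive_subgroup_diffI) (auto simp: minus_eq)

text \<open>By commutativity, \<open>H\<close> plus the span of \<open>X\<close> is already a
  subgroup, and it contains all generators of the left-hand span.\<close>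

lemma aspan_Un_split:
  assumes H: "additive_subgroup H G" and X: "X \<subseteq> carrier G" and v: "v \<in> aspan (H \<union> X)"
  obtains p q where "p \<in> H" "q \<in> aspan X" "v = p \<oplus> q"
proof -
  have sub: "H \<subseteq> carrier G" by (rule additive_subgroup.a_subset[OF H])
  have X': "additive_subgroup (aspan X) G" by (rule aspan_subgroup[OF X])
  have sg: "additive_subgroup (H <+>\<^bsub>G\<^esub> aspan X) G"
    unfolding set_add_def
    by (rule additive_subgroupI)
      (intro comm_group.mult_subgroups a_comm_group additive_subgroup.a_subgroup H X')
  have "H \<union> X \<subseteq> H <+>\<^bsub>G\<^esub> aspan X"
  proof
    fix x assume "x \<in> H \<union> X"
    then show "x \<in> H <+>\<^bsub>G\<^esub> aspan X"
    proof
      assume "x \<in> H"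
      then have "x = x \<oplus> \<zero>" using sub by auto
      then show ?thesis using \<open>x \<in> H\<close> additive_subgroup.zero_closed[OF X']
        unfolding set_add_def' by blast
    next
      assume "x \<in> X"
      then have "x = \<zero> \<oplus> x" "x \<in> aspan X" using X aspan_incl by auto
      then show ?thesis using additive_subgroup.zero_closed[OF H]
        unfolding set_add_def' by blast
    qed
  qed
  then have "v \<in> H <+>\<^bsub>G\<^esub> aspan X" using aspan_least[OF sg] v by blast
  then show ?thesis using that unfolding set_add_def' by blast
qed

end

text \<open>Turns the iterated sum of subgroups by which \<open>deletion_sum\<close> is defined into
  a single span, to which the span lemmas apply.\<close>

lemma (in abelian_group) foldr_set_add:
  assumes "\<And>H. H \<in> set Hs \<Longrightarrow> additive_subgroup H G"
  shows "foldr (<+>\<^bsub>G\<^esub>) Hs {\<zero>} = aspan (\<Union>(set Hs))"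
  using assms
proof (induction Hs)
  case Nil
  then show ?case
    using aspan_least[OF additive_subgroup_zero, of "{}"]
      additive_subgroup.zero_closed[OF aspan_subgroup[of "{}"]] by auto
next
  case (Cons H Hs)
  have H: "additive_subgroup H G" using Cons.prems by simp
  have sub: "\<Union>(set Hs) \<subseteq> carrier G"
    by (intro Union_least additive_subgroup.a_subset Cons.prems) simp
  have all: "additive_subgroup (aspan (H \<union> \<Union>(set Hs))) G"
    using aspan_subgroup sub additive_subgroup.a_subset[OF H] by auto
  have "H <+>\<^bsub>G\<^esub> aspan (\<Union>(set Hs)) = aspan (H \<union> \<Union>(set Hs))"
  proof
    have "H \<subseteq> aspan (H \<union> \<Union>(set Hs))" "aspan (\<Union>(set Hs)) \<subseteq> aspan (H \<union> \<Union>(set Hs))"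
      using aspan_incl[of "H \<union> \<Union>(set Hs)"] aspan_mono[of "\<Union>(set Hs)" "H \<union> \<Union>(set Hs)"] by auto
    then show "H <+>\<^bsub>G\<^esub> aspan (\<Union>(set Hs)) \<subseteq> aspan (H \<union> \<Union>(set Hs))"
      using additive_subgroup.a_closed[OF all] unfolding set_add_def' by blast
    show "aspan (H \<union> \<Union>(set Hs)) \<subseteq> H <+>\<^bsub>G\<^esub> aspan (\<Union>(set Hs))"
    proof
      fix v assume "v \<in> aspan (H \<union> \<Union>(set Hs))"
      from aspan_Un_split[OF H sub this] show "v \<in> H <+>\<^bsub>G\<^esub> aspan (\<Union>(set Hs))"
        unfolding set_add_def' by blast
    qed
  qed
  then show ?case using Cons by simp
qed

lemma (in abelian_group_hom) hom_minus:
  "x \<in> carrier G \<Longrightarrow> y \<in> carrier G \<Longrightarrow> h (x \<ominus> y) = h x \<ominus>\<^bsub>H\<^esub> h y"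
  by (simp add: G.minus_eq H.minus_eq)

lemma (in abelian_group_hom) additive_subgroup_preimage:
  assumes "additive_subgroup K H"
  shows "additive_subgroup {x \<in> carrier G. h x \<in> K} G"
proof -
  interpret K: additive_subgroup K H by fact
  show ?thesis
    by (rule G.additive_subgroup_diffI) (auto simp: hom_minus H.additive_subgroup_minus[OF assms])
qed

lemma (in abelian_group_hom) additive_subgroup_image:
  assumes "additive_subgroup K G"
  shows "additive_subgroup (h ` K) H"
proof -
  interpret K: additive_subgroup K G by fact
  show ?thesis
  proof (rule H.additive_subgroup_diffI)
    show "h ` K \<subseteq> carrier H" using K.a_subset by auto
    show "\<zero>\<^bsub>H\<^esub> \<in> h ` K" using K.zero_closed hom_zero by (metis image_eqI)
    fix x y assume "x \<in> h ` K" "y \<in> h ` K"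
    then obtain x' y' where xy: "x' \<in> K" "y' \<in> K" "x = h x'" "y = h y'" by blast
    then have "x' \<ominus> y' \<in> K" using G.additive_subgroup_minus[OF assms] by blast
    moreover have "h (x' \<ominus> y') = x \<ominus>\<^bsub>H\<^esub> y"
      using xy K.a_subset by (simp add: hom_minus subset_iff)
    ultimately show "x \<ominus>\<^bsub>H\<^esub> y \<in> h ` K" by (metis image_eqI)
  qed
qed

lemma (in abelian_group_hom) hom_finsum:
  "finite A \<Longrightarrow> f \<in> A \<rightarrow> carrier G \<Longrightarrow> h (finsum G f A) = (\<Oplus>\<^bsub>H\<^esub>i\<in>A. h (f i))"
  by (induction A rule: finite_induct) (auto simp: Pi_iff)

context abelian_group
begin

definition endo :: "('a \<Rightarrow> 'a) \<Rightarrow> bool" where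
  "endo f \<longleftrightarrow> f \<in> carrier G \<rightarrow> carrier G \<and>
     (\<forall>x\<in>carrier G. \<forall>y\<in>carrier G. f (x \<oplus> y) = f x \<oplus> f y)"

lemma endo_hom: "endo f \<Longrightarrow> abelian_group_hom G G f"
  by (rule abelian_group_homI)
    (auto simp: endo_def hom_def group_hom_def group_hom_axioms_def a_group abelian_group_axioms)

lemmas endo_closed = abelian_group_hom.hom_closed[OF endo_hom]
  and endo_zero = abelian_group_hom.hom_zero[OF endo_hom]
  and endo_minus = abelian_group_hom.hom_minus[OF endo_hom]
  and endo_preimage = abelian_group_hom.additive_subgroup_preimage[OF endo_hom]
  and endo_image = abelian_group_hom.additive_subgroup_image[OF endo_hom]

lemma endo_aspan_image:
  assumes "endo f" "X \<subseteq> carrier G"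
  shows "aspan (f ` X) \<subseteq> f ` aspan X"
  by (rule aspan_least[OF endo_image[OF assms(1) aspan_subgroup[OF assms(2)]]])
    (use aspan_incl in blast)

text \<open>The preimage of a subgroup is a subgroup, so it suffices to test generators.\<close>

lemma endo_aspan_into:
  assumes f: "endo f" and H: "additive_subgroup H G" and X: "X \<subseteq> carrier G"
    and into: "\<And>x. x \<in> X \<Longrightarrow> f x \<in> H" and x: "x \<in> aspan X"
  shows "f x \<in> H"
proof -
  have "aspan X \<subseteq> {x \<in> carrier G. f x \<in> H}"
    by (rule aspan_least[OF endo_preimage[OF f H]]) (use X into in auto)
  then show ?thesis using x by blast
qed

end

subsection \<open>Systems of subgroups permuted by transpositions\<close>

text \<open>Abstracts the symmetric group acting on one large \<open>V_U\<close>: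
  \<open>tau i j\<close> is the action of the transposition of \<open>i\<close> and
  \<open>j\<close>, and \<open>tau_conj\<close> is the rule for conjugating one transposition by
  another.\<close>

locale swap_action = abelian_group G for G (structure) +
  fixes tau :: "nat \<Rightarrow> nat \<Rightarrow> 'a \<Rightarrow> 'a" and \<Omega> :: "nat set"
  assumes tau_endo: "i \<in> \<Omega> \<Longrightarrow> j \<in> \<Omega> \<Longrightarrow> endo (tau i j)"
    and tau_commute: "i \<in> \<Omega> \<Longrightarrow> j \<in> \<Omega> \<Longrightarrow> tau i j = tau j i"
    and tau_conj: "i \<in> \<Omega> \<Longrightarrow> j \<in> \<Omega> \<Longrightarrow> k \<in> \<Omega> \<Longrightarrow> l \<in> \<Omega> \<Longrightarrow> v \<in> carrier G \<Longrightarrow>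
      tau i j (tau k l v) = tau (transpose i j k) (transpose i j l) (tau i j v)"
begin

section \<open>The operators \<open>J\<close>, systems of subgroups and their hypotheses\<close>

definition J :: "nat \<Rightarrow> nat \<Rightarrow> 'a \<Rightarrow> 'a" where
  "J i j v = v \<ominus> tau i j v"

definition Jprod :: "(nat \<times> nat) list \<Rightarrow> 'a \<Rightarrow> 'a" where
  "Jprod ps = foldr (\<lambda>(i, j). J i j) ps"

definition disjoint_pairs :: "nat set \<Rightarrow> (nat \<times> nat) list \<Rightarrow> bool" where
  "disjoint_pairs U ps \<longleftrightarrow> distinct (map fst ps @ map snd ps) \<and> fst ` set ps \<union> snd ` set ps \<subseteq> U"

text \<open>Models the copies of all \<open>V_T\<close> inside \<open>V_U\<close>. The last clause
  says that a transposition acts trivially on elements supported away from both of its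
  points.\<close>

definition swap_system :: "nat set \<Rightarrow> (nat set \<Rightarrow> 'a set) \<Rightarrow> bool" where
  "swap_system U V \<longleftrightarrow> finite U \<and> U \<subseteq> \<Omega> \<and>
     (\<forall>T\<subseteq>U. additive_subgroup (V T) G \<and> (\<forall>S\<subseteq>T. V S \<subseteq> V T) \<and>
       (\<forall>i\<in>U. \<forall>j\<in>U. \<forall>v\<in>V T. tau i j v \<in> V (transpose i j ` T) \<and>
         (i \<notin> T \<longrightarrow> j \<notin> T \<longrightarrow> tau i j v = v)))"

text \<open>Vanishing of \<open>H_0\<close> above rank \<open>d\<close>, phrased with one-point
  deletions in place of all smaller sets.\<close>

definition generated :: "nat set \<Rightarrow> (nat set \<Rightarrow> 'a set) \<Rightarrow> nat \<Rightarrow> bool" where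
  "generated U V d \<longleftrightarrow> (\<forall>T\<subseteq>U. d < card T \<longrightarrow> V T \<subseteq> aspan (\<Union>t\<in>T. V (T - {t})))"

text \<open>The operators \<open>Jprod ps\<close> are the generators of the ideal
  \<open>I_m\<close>. Testing them on \<open>V U\<close> is enough to reach every
  \<open>V T\<close>, by monotonicity.\<close>

definition annihilated :: "nat set \<Rightarrow> (nat set \<Rightarrow> 'a set) \<Rightarrow> nat \<Rightarrow> bool" where
  "annihilated U V m \<longleftrightarrow>
     (\<forall>ps. length ps = m \<longrightarrow> disjoint_pairs U ps \<longrightarrow> (\<forall>v\<in>V U. Jprod ps v = \<zero>))"

definition del_span :: "(nat set \<Rightarrow> 'a set) \<Rightarrow> nat set \<Rightarrow> nat set \<Rightarrow> 'a set" where
  "del_span V N B = aspan (\<Union>b\<in>B. V (N - {b}))"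

section \<open>Commutation and vanishing of products of \<open>J\<close>\<close>

lemma J_endo:
  assumes "i \<in> \<Omega>" "j \<in> \<Omega>"
  shows "endo (J i j)"
  unfolding endo_def
proof (intro conjI ballI)
  note t = tau_endo[OF assms]
  show "J i j \<in> carrier G \<rightarrow> carrier G" using t by (auto simp: J_def endo_closed)
  fix x y assume xy: "x \<in> carrier G" "y \<in> carrier G"
  then have "tau i j (x \<oplus> y) = tau i j x \<oplus> tau i j y" using t by (simp add: endo_def)
  moreover have "tau i j x \<in> carrier G" "tau i j y \<in> carrier G" using t xy by (auto simp: endo_closed)
  ultimately show "J i j (x \<oplus> y) = J i j x \<oplus> J i j y"
    using xy by (simp add: J_def minus_eq minus_add a_ac)
qed

lemma Jprod_Nil [simp]: "Jprod [] v = v"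
  by (simp add: Jprod_def)

lemma Jprod_Cons [simp]: "Jprod (p # ps) v = J (fst p) (snd p) (Jprod ps v)"
  by (simp add: Jprod_def case_prod_beta)

lemma Jprod_endo: "fst ` set ps \<union> snd ` set ps \<subseteq> \<Omega> \<Longrightarrow> endo (Jprod ps)"
proof (induction ps)
  case Nil
  then show ?case by (simp add: endo_def)
next
  case (Cons p ps)
  then have "endo (Jprod ps)" "endo (J (fst p) (snd p))" by (auto intro: J_endo)
  then show ?case by (auto simp: endo_def Pi_iff)
qed

lemma tau_tau_commute:
  assumes "{i, j, k, l} \<subseteq> \<Omega>" "{i, j} \<inter> {k, l} = {}" "v \<in> carrier G"
  shows "tau i j (tau k l v) = tau k l (tau i j v)"
  using tau_conj[of i j k l v] assms by (simp add: transpose_apply_other)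

lemma tau_J_commute:
  assumes "{i, j, k, l} \<subseteq> \<Omega>" "{i, j} \<inter> {k, l} = {}" "v \<in> carrier G"
  shows "tau i j (J k l v) = J k l (tau i j v)"
proof -
  have "tau k l v \<in> carrier G" using tau_endo endo_closed assms by auto
  then show ?thesis
    using assms tau_tau_commute[OF assms] by (simp add: J_def endo_minus tau_endo)
qed

lemma J_J_commute:
  assumes "{i, j, k, l} \<subseteq> \<Omega>" "{i, j} \<inter> {k, l} = {}" "v \<in> carrier G"
  shows "J i j (J k l v) = J k l (J i j v)"
proof -
  have "tau i j v \<in> carrier G" "endo (J k l)" using tau_endo endo_closed J_endo assms by auto
  then show ?thesis
    using assms tau_J_commute[OF assms] by (simp add: J_def[of i j] endo_minus)
qed

lemma Jprod_J_commute:
  assumes "{i, j} \<subseteq> \<Omega>" "fst ` set ps \<union> snd ` set ps \<subseteq> \<Omega> - {i, j}" "v \<in> carrier G"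
  shows "Jprod ps (J i j v) = J i j (Jprod ps v)"
  using assms(2)
proof (induction ps)
  case (Cons p ps)
  have "Jprod ps v \<in> carrier G" by (rule endo_closed[OF Jprod_endo assms(3)]) (use Cons in auto)
  then show ?case using Cons assms(1) J_J_commute[of "fst p" "snd p" i j "Jprod ps v"] by auto
qed simp

text \<open>\<open>J\<close> is symmetric in its indices. This reconciles \<open>J_tilde\<close>,
  where the star comes first in each pair, with the convention that first entries lie in
  \<open>N\<close>.\<close>

lemma Jprod_swap: "fst ` set ps \<union> snd ` set ps \<subseteq> \<Omega> \<Longrightarrow> Jprod (map prod.swap ps) v = Jprod ps v"
  by (induction ps) (auto simp: J_def tau_commute)

lemma J_eq_zero_iff:
  assumes "i \<in> \<Omega>" "j \<in> \<Omega>" "v \<in> carrier G"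
  shows "J i j v = \<zero> \<longleftrightarrow> tau i j v = v"
  using assms endo_closed[OF tau_endo, of i j v] minus_eq_zero_iff[of v "tau i j v"]
  by (auto simp: J_def)

lemma swap_systemD:
  assumes "swap_system U V"
  shows "finite U" "U \<subseteq> \<Omega>"
    and "T \<subseteq> U \<Longrightarrow> additive_subgroup (V T) G"
    and "S \<subseteq> T \<Longrightarrow> T \<subseteq> U \<Longrightarrow> V S \<subseteq> V T"
    and "T \<subseteq> U \<Longrightarrow> i \<in> U \<Longrightarrow> j \<in> U \<Longrightarrow> v \<in> V T \<Longrightarrow> tau i j v \<in> V (transpose i j ` T)"
    and "T \<subseteq> U \<Longrightarrow> i \<in> U \<Longrightarrow> j \<in> U \<Longrightarrow> v \<in> V T \<Longrightarrow> i \<notin> T \<Longrightarrow> j \<notin> T \<Longrightarrow> tau i j v = v"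
  using assms unfolding swap_system_def by (simp_all (no_asm_simp))

lemma swap_system_carrier: "swap_system U V \<Longrightarrow> T \<subseteq> U \<Longrightarrow> V T \<subseteq> carrier G"
  by (rule additive_subgroup.a_subset[OF swap_systemD(3)])

lemma del_carrier: "swap_system U V \<Longrightarrow> N \<subseteq> U \<Longrightarrow> (\<Union>b\<in>B. V (N - {b})) \<subseteq> carrier G"
  by (intro UN_least swap_system_carrier) auto

lemma del_span_subgroup: "swap_system U V \<Longrightarrow> N \<subseteq> U \<Longrightarrow> additive_subgroup (del_span V N B) G"
  unfolding del_span_def by (rule aspan_subgroup[OF del_carrier])

lemma del_span_subset:
  assumes "swap_system U V" "N \<subseteq> U"
  shows "del_span V N B \<subseteq> V N"
  unfolding del_span_def
  by (rule aspan_least[OF swap_systemD(3)[OF assms]]) (intro UN_least swap_systemD(4)[OF assms(1) Diff_subset assms(2)])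

lemma del_span_incl: "b \<in> B \<Longrightarrow> V (N - {b}) \<subseteq> del_span V N B"
  unfolding del_span_def by (rule order_trans[OF _ aspan_incl]) (rule UN_upper)

lemma del_span_mono: "B \<subseteq> C \<Longrightarrow> del_span V N B \<subseteq> del_span V N C"
  unfolding del_span_def by (rule aspan_mono) blast

lemma J_vanish:
  assumes "swap_system U V" "T \<subseteq> U" "i \<in> U - T" "j \<in> U - T" "v \<in> V T"
  shows "J i j v = \<zero>"
  using assms swap_systemD(2,6)[OF assms(1)] swap_system_carrier[OF assms(1,2)]
  by (subst J_eq_zero_iff) auto

lemma disjoint_pairsD:
  assumes "disjoint_pairs U (p # ps)"
  shows "fst p \<in> U" "snd p \<in> U" "fst p \<noteq> snd p" "disjoint_pairs (U - {fst p, snd p}) ps"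
    "disjoint_pairs U ps" "fst ` set ps \<union> snd ` set ps \<subseteq> U - {fst p, snd p}"
  using assms unfolding disjoint_pairs_def by (auto simp: image_iff)

text \<open>The easy inclusion. On the summand \<open>V (N - {b})\<close> the factor with first
  index \<open>b\<close> can be moved past the others to act first, and it gives zero because
  neither of its indices lies in \<open>N - {b}\<close>.\<close>

lemma Jprod_vanish:
  assumes V: "swap_system U V" and N: "N \<subseteq> U" and ps: "disjoint_pairs U ps"
    and sub: "fst ` set ps \<subseteq> N" "snd ` set ps \<subseteq> U - N"
    and v: "v \<in> del_span V N (fst ` set ps)"
  shows "Jprod ps v = \<zero>"
proof -
  note U = swap_systemD(2)[OF V]
  have end_ps: "endo (Jprod qs)" if "disjoint_pairs U qs" for qs
    by (rule Jprod_endo) (use that U in \<open>auto simp: disjoint_pairs_def\<close>)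
  have single: "Jprod qs v = \<zero>"
    if "disjoint_pairs U qs" "b \<in> fst ` set qs" "snd ` set qs \<subseteq> U - N" "v \<in> V (N - {b})" for qs b v
    using that(1-3)
  proof (induction qs)
    case (Cons p qs)
    note p = disjoint_pairsD[OF Cons.prems(1)]
    have v: "v \<in> carrier G" using that(4) swap_system_carrier[OF V, of "N - {b}"] N by blast
    have J0: "J (fst p) (snd p) \<zero> = \<zero>" by (rule endo_zero[OF J_endo]) (use p U in auto)
    show ?case
    proof (cases "b = fst p")
      case True
      have "Jprod qs (J (fst p) (snd p) v) = J (fst p) (snd p) (Jprod qs v)"
        by (rule Jprod_J_commute) (use p U v in auto)
      moreover have "J (fst p) (snd p) v = \<zero>"
        by (rule J_vanish[OF V _ _ _ that(4)]) (use p N True Cons.prems in auto)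
      ultimately show ?thesis using endo_zero[OF end_ps[OF p(5)]] by simp
    next
      case False
      then show ?thesis using Cons p J0 by auto
    qed
  qed auto
  have "Jprod ps v \<in> {\<zero>}"
    by (rule endo_aspan_into[OF end_ps[OF ps] additive_subgroup_zero del_carrier[OF V N]])
      (use single[OF ps _ sub(2)] v in \<open>auto simp: del_span_def simp del: UN_simps\<close>)
  then show ?thesis by simp
qed

section \<open>Spanning \<open>V N\<close> by small sets, and by deletions at prescribed
  points\<close>

lemma span_small:
  assumes V: "swap_system U V" and gen: "generated U V d" and N: "N \<subseteq> U"
  shows "V N \<subseteq> aspan (\<Union>S\<in>{S. S \<subseteq> N \<and> card S \<le> d}. V S)"
  using N
proof (induction "card N" arbitrary: N)
  case 0
  then show ?case using aspan_incl by force
next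
  case (Suc c)
  let ?X = "\<lambda>N. \<Union>S\<in>{S. S \<subseteq> N \<and> card S \<le> d}. V S"
  show ?case
  proof (cases "card N \<le> d")
    case True
    then show ?thesis using aspan_incl[of "?X N"] by blast
  next
    case False
    have car: "?X N \<subseteq> carrier G" using swap_system_carrier[OF V] Suc.prems by blast
    have "V (N - {t}) \<subseteq> aspan (?X N)" if "t \<in> N" for t
    proof -
      have "c = card (N - {t})" using Suc.hyps(2) that
        by (metis card.infinite card_Diff_singleton diff_Suc_1 nat.simps(3))
      then have "V (N - {t}) \<subseteq> aspan (?X (N - {t}))" using Suc by blast
      also have "\<dots> \<subseteq> aspan (?X N)" by (rule aspan_mono) blast
      finally show ?thesis .
    qed
    then have "aspan (\<Union>t\<in>N. V (N - {t})) \<subseteq> aspan (?X N)"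
      by (intro aspan_least[OF aspan_subgroup[OF car]]) blast
    moreover have "V N \<subseteq> aspan (\<Union>t\<in>N. V (N - {t}))"
      using gen Suc.prems False unfolding generated_def by (meson not_le)
    ultimately show ?thesis by blast
  qed
qed

text \<open>When the product is multiplied out, every term except the identity applies some
  \<open>tau b j\<close> with \<open>j\<close> outside \<open>S\<close>, and hence lands in a group
  whose index set misses \<open>b\<close>.\<close>

lemma Jprod_expand:
  assumes V: "swap_system U V" and S: "S \<subseteq> N" and N: "N \<subseteq> U" and ps: "disjoint_pairs N ps"
    and sub: "snd ` set ps \<inter> S = {}" and v: "v \<in> V S"
  shows "Jprod ps v \<ominus> v \<in> del_span V N (fst ` set ps)"
  using ps sub
proof (induction ps)
  case Nil
  have "v \<in> carrier G" using v swap_system_carrier[OF V, of S] S N by blast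
  then show ?case using additive_subgroup.zero_closed[OF del_span_subgroup[OF V N]]
    by (simp add: minus_eq r_neg)
next
  case (Cons p ps)
  note p = disjoint_pairsD[OF Cons.prems(1)]
  note U = swap_systemD(2)[OF V]
  obtain b j where bj: "p = (b, j)" by (cases p)
  have b: "b \<in> N" "j \<in> N" "b \<noteq> j" "j \<notin> S" using p(1-3) Cons.prems(2) bj by auto
  let ?D = "del_span V N (fst ` set ps)" and ?E = "del_span V N (fst ` set (p # ps))"
  have E: "additive_subgroup ?E G" by (rule del_span_subgroup[OF V N])
  have vc: "v \<in> carrier G" using v swap_system_carrier[OF V, of S] S N by blast
  define y where "y = Jprod ps v \<ominus> v"
  have y: "y \<in> ?D" unfolding y_def by (rule Cons.IH[OF p(5)]) (use Cons.prems(2) in auto)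
  have yc: "y \<in> carrier G" using additive_subgroup.a_subset[OF del_span_subgroup[OF V N]] y by blast
  have eps: "endo (Jprod ps)" by (rule Jprod_endo) (use p(6) N U in blast)
  have et: "endo (tau b j)" by (rule tau_endo) (use b N U in blast)+
  have Jv: "Jprod ps v \<in> carrier G" by (rule endo_closed[OF eps vc])
  \<comment> \<open>Since \<open>j\<close> is not in \<open>S\<close>, the swapped set
    \<open>transpose b j\<close> applied to \<open>S\<close> does not contain
    \<open>b\<close>.\<close>
  have tv: "tau b j v \<in> ?E"
  proof -
    have "tau b j v \<in> V (transpose b j ` S)"
      by (rule swap_systemD(5)[OF V _ _ _ v]) (use b N S in blast)+
    moreover have "transpose b j ` S \<subseteq> N - {b}"
      using b S by (auto simp: transpose_def)
    ultimately have "tau b j v \<in> V (N - {b})" using swap_systemD(4)[OF V] N by blast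
    then show ?thesis by (rule subsetD[OF del_span_incl, rotated]) (simp add: bj)
  qed
  \<comment> \<open>The pairs are disjoint, so \<open>b\<close> and \<open>j\<close> differ from
    every earlier \<open>c\<close>, and \<open>tau b j\<close> preserves each
    \<open>V (N - {c})\<close>.\<close>
  have ty: "tau b j y \<in> ?E"
  proof (rule endo_aspan_into[OF et E del_carrier[OF V N]])
    show "y \<in> aspan (\<Union>b\<in>fst ` set ps. V (N - {b}))" using y by (simp add: del_span_def)
    fix x assume "x \<in> (\<Union>b\<in>fst ` set ps. V (N - {b}))"
    then obtain c where c: "c \<in> fst ` set ps" "x \<in> V (N - {c})" by blast
    have "tau b j x \<in> V (transpose b j ` (N - {c}))"
      by (rule swap_systemD(5)[OF V _ _ _ c(2)]) (use b N in blast)+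
    moreover have "transpose b j ` (N - {c}) \<subseteq> N - {c}"
    proof -
      have "c \<noteq> b" "c \<noteq> j" using p(6) bj c(1) by auto
      then show ?thesis using b by (auto simp: transpose_def)
    qed
    ultimately have "tau b j x \<in> V (N - {c})" using swap_systemD(4)[OF V] N by blast
    then show "tau b j x \<in> ?E" by (rule subsetD[OF del_span_incl, rotated]) (use c in simp)
  qed
  have yE: "y \<in> ?E" by (rule subsetD[OF del_span_mono y]) auto
  have tvc: "tau b j v \<in> carrier G" "tau b j y \<in> carrier G" by (rule endo_closed[OF et vc], rule endo_closed[OF et yc])
  have "Jprod ps v = v \<oplus> y" using vc Jv unfolding y_def by (simp add: plus_minus_cancel)
  then have "tau b j (Jprod ps v) = tau b j v \<oplus> tau b j y" using et vc yc by (simp add: endo_def)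
  then have tE: "tau b j (Jprod ps v) \<in> ?E" using additive_subgroup.a_closed[OF E tv ty] by simp
  have "tau b j (Jprod ps v) \<in> carrier G" by (rule endo_closed[OF et Jv])
  then have "Jprod (p # ps) v \<ominus> v = y \<ominus> tau b j (Jprod ps v)"
    using bj vc Jv by (simp add: J_def y_def minus_eq a_ac)
  also have "\<dots> \<in> ?E" by (rule additive_subgroup_minus[OF E yE tE])
  finally show ?case .
qed

lemma disjoint_pairs_mono: "disjoint_pairs U ps \<Longrightarrow> U \<subseteq> U' \<Longrightarrow> disjoint_pairs U' ps"
  unfolding disjoint_pairs_def by blast

lemma ex_disjoint_pairs:
  assumes "finite B" "finite C" "card B \<le> card C" "B \<inter> C = {}"
  obtains ps where "disjoint_pairs (B \<union> C) ps" "fst ` set ps = B" "snd ` set ps \<subseteq> C" "length ps = card B"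
proof -
  obtain C' where C': "C' \<subseteq> C" "card C' = card B" by (meson assms(3) obtain_subset_with_card_n)
  obtain bs cs where bs: "set bs = B" "distinct bs" and cs: "set cs = C'" "distinct cs"
    by (meson assms(1,2) C'(1) finite_distinct_list finite_subset)
  have len: "length bs = card B" "length cs = card B"
    using bs cs C'(2) distinct_card by fastforce+
  then have maps: "map fst (zip bs cs) = bs" "map snd (zip bs cs) = cs" by simp_all
  then have "fst ` set (zip bs cs) = B" "snd ` set (zip bs cs) = C'"
    using bs cs by (metis list.set_map)+
  moreover have "distinct (bs @ cs)" using bs cs C'(1) assms(4) by auto
  ultimately show ?thesis
    using that[of "zip bs cs"] len C'(1) unfolding disjoint_pairs_def maps by auto
qed

text \<open>By \<open>span_small\<close> only \<open>V S\<close> with \<open>card S \<le> d\<close>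
  matters. If \<open>S\<close> misses a point of \<open>B\<close>, then \<open>V S\<close> lies in
  one of the summands. Otherwise \<open>N - S\<close> has at least \<open>m\<close> points to pair
  with \<open>B\<close>, and the product of these \<open>m\<close> factors vanishes.\<close>

lemma cover:
  assumes V: "swap_system U V" and gen: "generated U V d" and ann: "annihilated U V m"
    and N: "N \<subseteq> U" and card: "m + d \<le> card N" and B: "B \<subseteq> N" "card B = m"
  shows "V N \<subseteq> del_span V N B"
proof -
  have fin: "finite N" using N swap_systemD(1)[OF V] by (rule finite_subset)
  have D: "additive_subgroup (del_span V N B) G" by (rule del_span_subgroup[OF V N])
  have "V S \<subseteq> del_span V N B" if S: "S \<subseteq> N" "card S \<le> d" for S
  proof (cases "B \<subseteq> S")
    case False
    then obtain b where b: "b \<in> B" "b \<notin> S" by blast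
    have "V S \<subseteq> V (N - {b})" by (rule swap_systemD(4)[OF V]) (use S b N in blast)+
    then show ?thesis using del_span_incl[OF b(1), of V N] by (rule order_trans)
  next
    case True
    have finS: "finite S" "finite B" "finite (N - S)" using fin S(1) B(1) finite_subset by auto
    have "card B \<le> card (N - S)" using card S(2) B(2) card_Diff_subset[OF finS(1) S(1)] by linarith
    moreover have "B \<inter> (N - S) = {}" using True by blast
    ultimately obtain ps where ps: "disjoint_pairs (B \<union> (N - S)) ps" "fst ` set ps = B"
      "snd ` set ps \<subseteq> N - S" "length ps = card B"
      by (rule ex_disjoint_pairs[OF finS(2,3)])
    have psN: "disjoint_pairs N ps" "disjoint_pairs U ps"
      by (rule disjoint_pairs_mono[OF ps(1)], use B(1) N in blast)+
    show ?thesis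
    proof
      fix v assume v: "v \<in> V S"
      have SU: "S \<subseteq> U" using S N by blast
      have vc: "v \<in> carrier G" using swap_system_carrier[OF V SU] v by blast
      have "v \<in> V U" by (rule subsetD[OF swap_systemD(4)[OF V SU order_refl] v])
      then have "Jprod ps v = \<zero>" using ann psN(2) ps(4) B(2) unfolding annihilated_def by blast
      moreover have "Jprod ps v \<ominus> v \<in> del_span V N (fst ` set ps)"
        by (rule Jprod_expand[OF V S(1) N psN(1) _ v]) (use ps(3) in blast)
      \<comment> \<open>The product is zero, so the error term of the expansion is
        \<open>\<ominus> v\<close> itself.\<close>
      ultimately have "\<ominus> v \<in> del_span V N B" using ps(2) vc by (simp add: minus_eq)
      from additive_subgroup.a_inv_closed[OF D this]
      show "v \<in> del_span V N B" using vc by simp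
    qed
  qed
  then have "aspan (\<Union>S\<in>{S. S \<subseteq> N \<and> card S \<le> d}. V S) \<subseteq> del_span V N B"
    by (intro aspan_least[OF D]) blast
  with span_small[OF V gen N] show ?thesis by (rule order_trans)
qed

section \<open>The system obtained by applying one operator \<open>J a s\<close>\<close>

definition derived :: "nat \<Rightarrow> nat \<Rightarrow> (nat set \<Rightarrow> 'a set) \<Rightarrow> nat set \<Rightarrow> 'a set" where
  "derived a s V T = J a s ` V (insert a T)"

context
  fixes U V a s
  assumes V: "swap_system U V" and as: "a \<in> U" "s \<in> U" "a \<noteq> s"
begin

lemma J_endo_as: "endo (J a s)"
  using J_endo as swap_systemD(2)[OF V] by blast

text \<open>\<open>J a s\<close> commutes with \<open>tau i j\<close> for \<open>i\<close>,
  \<open>j\<close> outside \<open>{a, s}\<close>, and such swaps fix \<open>a\<close>, so each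
  property of \<open>V\<close> at \<open>insert a T\<close> passes to the image.\<close>

lemma derived_swap_system: "swap_system (U - {a, s}) (derived a s V)"
  unfolding swap_system_def
proof (intro conjI allI ballI impI)
  show "finite (U - {a, s})" "U - {a, s} \<subseteq> \<Omega>" using swap_systemD(1,2)[OF V] by auto
  fix T assume T: "T \<subseteq> U - {a, s}"
  then have aT: "insert a T \<subseteq> U" using as by blast
  show "additive_subgroup (derived a s V T) G"
    unfolding derived_def by (rule endo_image[OF J_endo_as swap_systemD(3)[OF V aT]])
  show "derived a s V S \<subseteq> derived a s V T" if "S \<subseteq> T" for S
    unfolding derived_def by (intro image_mono swap_systemD(4)[OF V _ aT]) (use that in blast)
  fix i j v assume i: "i \<in> U - {a, s}" and j: "j \<in> U - {a, s}" and "v \<in> derived a s V T"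
  then obtain u where u: "u \<in> V (insert a T)" "v = J a s u" unfolding derived_def by blast
  have uc: "u \<in> carrier G" using swap_system_carrier[OF V aT] u(1) by blast
  have tv: "tau i j v = J a s (tau i j u)"
    unfolding u(2) by (rule tau_J_commute) (use i j as uc swap_systemD(2)[OF V] in auto)
  have iU: "i \<in> U" "j \<in> U" using i j by auto
  have "tau i j u \<in> V (transpose i j ` insert a T)" by (rule swap_systemD(5)[OF V aT iU u(1)])
  moreover have "transpose i j a = a" using i j by (auto simp: transpose_def)
  ultimately show "tau i j v \<in> derived a s V (transpose i j ` T)"
    unfolding tv derived_def by (metis image_eqI image_insert)
  assume "i \<notin> T" "j \<notin> T"
  then have "tau i j u = u" using i j by (intro swap_systemD(6)[OF V aT iU u(1)]) auto
  then show "tau i j v = v" using tv u(2) by simp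
qed

text \<open>Passing from \<open>T\<close> to \<open>insert a T\<close> gains one element, and the
  extra summand, with \<open>a\<close> deleted, is killed by \<open>J a s\<close>.\<close>

lemma derived_generated:
  assumes gen: "generated U V d"
  shows "generated (U - {a, s}) (derived a s V) (d - 1)"
  unfolding generated_def
proof (intro allI impI)
  fix T assume T: "T \<subseteq> U - {a, s}" and card: "d - 1 < card T"
  have aT: "insert a T \<subseteq> U" "a \<notin> T" using T as by auto
  have TU: "T - {t} \<subseteq> U - {a, s}" for t using T by blast
  have "finite T" using T swap_systemD(1)[OF V] finite_subset by blast
  \<comment> \<open>This includes \<open>d = 0\<close>, where the truncated \<open>d - 1\<close> is
    again \<open>0\<close>.\<close>
  then have "d < card (insert a T)" using aT(2) card by simp
  then have le: "V (insert a T) \<subseteq> aspan (\<Union>t\<in>insert a T. V (insert a T - {t}))"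
    using gen aT(1) unfolding generated_def by blast
  let ?X = "\<Union>t\<in>T. derived a s V (T - {t})"
  have X: "?X \<subseteq> carrier G" by (intro UN_least swap_system_carrier[OF derived_swap_system TU])
  note S = aspan_subgroup[OF X]
  show "derived a s V T \<subseteq> aspan ?X"
  proof
    fix v assume "v \<in> derived a s V T"
    then obtain u where u: "u \<in> V (insert a T)" "v = J a s u" unfolding derived_def by blast
    have "J a s u \<in> aspan ?X"
    proof (rule endo_aspan_into[OF J_endo_as S del_carrier[OF V aT(1)] _ subsetD[OF le u(1)]])
      fix x assume "x \<in> (\<Union>t\<in>insert a T. V (insert a T - {t}))"
      then obtain t where t: "t \<in> insert a T" "x \<in> V (insert a T - {t})" by blast
      show "J a s x \<in> aspan ?X"
      proof (cases "t = a")
        case True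
        then have "x \<in> V T" using t aT by simp
        then have "J a s x = \<zero>" by (rule J_vanish[OF V, rotated -1]) (use T as in auto)
        then show ?thesis using additive_subgroup.zero_closed[OF S] by simp
      next
        case False
        then have "insert a T - {t} = insert a (T - {t})" by blast
        then have "J a s x \<in> ?X" using t False unfolding derived_def by auto
        then show ?thesis using aspan_incl[of ?X] by blast
      qed
    qed
    then show "v \<in> aspan ?X" using u by simp
  qed
qed

text \<open>A disjoint list in \<open>U - {a, s}\<close> stays disjoint when \<open>(a, s)\<close>
  is prepended, and \<open>J a s\<close> supplies the missing factor.\<close>

lemma derived_annihilated:
  assumes ann: "annihilated U V (Suc m)"
  shows "annihilated (U - {a, s}) (derived a s V) m"
  unfolding annihilated_def
proof (intro allI impI ballI)
  fix ps v assume ps: "length ps = m" "disjoint_pairs (U - {a, s}) ps"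
    and "v \<in> derived a s V (U - {a, s})"
  then obtain u where u: "u \<in> V (insert a (U - {a, s}))" "v = J a s u" unfolding derived_def by blast
  have uU: "u \<in> V U" by (rule subsetD[OF swap_systemD(4)[OF V _ order_refl] u(1)]) (use as in blast)
  have uc: "u \<in> carrier G" using uU swap_system_carrier[OF V order_refl] by blast
  have "disjoint_pairs U ((a, s) # ps)"
    using ps(2) as unfolding disjoint_pairs_def by auto
  then have "Jprod ((a, s) # ps) u = \<zero>" using ann ps(1) uU unfolding annihilated_def by (metis length_Cons)
  moreover have "Jprod ps (J a s u) = J a s (Jprod ps u)"
    by (rule Jprod_J_commute)
      (use uc as ps(2) swap_systemD(2)[OF V] in \<open>auto simp: disjoint_pairs_def\<close>)
  ultimately show "Jprod ps v = \<zero>" using u(2) by simp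
qed

text \<open>Lifts a conclusion about the derived system back to \<open>V\<close>: a span of images
  lies in the image of the span. As \<open>a\<close> is not in \<open>B\<close>, inserting
  \<open>a\<close> commutes with deleting points of \<open>B\<close>.\<close>

lemma derived_del_span:
  assumes "T \<subseteq> U - {a, s}" "B \<subseteq> T" "w \<in> del_span (derived a s V) T B"
  obtains u where "u \<in> del_span V (insert a T) B" "w = J a s u"
proof -
  have aT: "insert a T \<subseteq> U" using assms(1) as by blast
  have eq: "(\<Union>b\<in>B. derived a s V (T - {b})) = J a s ` (\<Union>b\<in>B. V (insert a T - {b}))"
  proof -
    have "insert a (T - {b}) = insert a T - {b}" if "b \<in> B" for b using that assms(1,2) by blast
    then show ?thesis by (auto simp: derived_def)
  qed
  have "w \<in> J a s ` del_span V (insert a T) B"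
    using assms(3) endo_aspan_image[OF J_endo_as del_carrier[OF V aT]]
    unfolding del_span_def eq by blast
  then show ?thesis using that by blast
qed

end

text \<open>The hard inclusion with \<open>k\<close> in the role of \<open>K\<close>, quantified
  over all systems because the induction passes to derived ones. The bound
  \<open>2 * card N < card U\<close> leaves enough labels outside \<open>N\<close>, and it survives
  the removal of one point from \<open>N\<close> and two from \<open>U\<close>.\<close>

definition kernel_spanned :: "nat \<Rightarrow> bool" where
  "kernel_spanned k \<longleftrightarrow> (\<forall>U V d N ps v. swap_system U V \<longrightarrow> generated U V d \<longrightarrow>
     annihilated U V (Suc k) \<longrightarrow> N \<subseteq> U \<longrightarrow> k + d < card N \<longrightarrow> 2 * card N < card U \<longrightarrow>
     disjoint_pairs U ps \<longrightarrow> fst ` set ps \<subseteq> N \<longrightarrow> snd ` set ps \<subseteq> U - N \<longrightarrow>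
     v \<in> V N \<longrightarrow> Jprod ps v = \<zero> \<longrightarrow> v \<in> del_span V N (fst ` set ps))"

lemma kernel_spannedD:
  assumes "kernel_spanned k" "swap_system U V" "generated U V d" "annihilated U V (Suc k)"
    "N \<subseteq> U" "k + d < card N" "2 * card N < card U" "disjoint_pairs U ps"
    "fst ` set ps \<subseteq> N" "snd ` set ps \<subseteq> U - N" "v \<in> V N" "Jprod ps v = \<zero>"
  shows "v \<in> del_span V N (fst ` set ps)"
  using assms unfolding kernel_spanned_def by blast

section \<open>The kernel of a single factor\<close>

lemma del_span_singleton: "swap_system U V \<Longrightarrow> N \<subseteq> U \<Longrightarrow> del_span V N {x} = V (N - {x})"
  unfolding del_span_def
  by (intro subset_antisym aspan_least swap_systemD(3)) (use aspan_incl in auto)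

lemma del_span_insert:
  assumes V: "swap_system U V" and N: "N \<subseteq> U" and v: "v \<in> del_span V N (insert b B)"
  obtains p q where "p \<in> V (N - {b})" "q \<in> del_span V N B" "v = p \<oplus> q"
proof (rule aspan_Un_split[OF swap_systemD(3)[OF V, of "N - {b}"] del_carrier[OF V N, of B]])
  show "N - {b} \<subseteq> U" using N by blast
  show "v \<in> aspan (V (N - {b}) \<union> (\<Union>b\<in>B. V (N - {b})))"
    using v unfolding del_span_def by (simp only: UN_insert)
qed (use that in \<open>simp add: del_span_def\<close>)

context
  fixes U V d N x s k
  assumes V: "swap_system U V" and gen: "generated U V d" and ann: "annihilated U V (Suc (Suc k))"
    and N: "N \<subseteq> U" and cardN: "Suc k + d < card N" and cardU: "2 * card N < card U"
    and x: "x \<in> N" and s: "s \<in> U - N" and IH: "kernel_spanned k" and d: "0 < d"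
begin

text \<open>
  For a suitable \<open>u\<close> in the span over \<open>B\<close>, the swaps \<open>(x s)\<close> and \<open>(b z)\<close> with \<open>s, z \<notin> N\<close> both fix \<open>q - u\<close>,
  hence so does \<open>(x b)\<close>, which carries the summand indexed by \<open>b\<close> to the one indexed by \<open>x\<close>.
\<close>

lemma exchange:
  assumes B: "insert b B \<subseteq> N - {x}" "b \<notin> B"
    and q: "q \<in> del_span V N (insert b B)" and Jq: "J x s q = \<zero>"
  shows "q \<in> del_span V N (insert x B)"
proof -
  have finU: "finite U" and U\<Omega>: "U \<subseteq> \<Omega>" by (fact swap_systemD[OF V])+
  have finN: "finite N" using N finU finite_subset by blast
  have bN: "b \<in> N" "b \<noteq> x" "B \<subseteq> N - {x, b}" using B by auto
  have cardUN: "card (U - N) = card U - card N" using card_Diff_subset finN N by blast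
  then have "card {s} < card (U - N)" using cardU cardN by simp
  then have "\<not> U - N \<subseteq> {s}" using card_mono[of "{s}" "U - N"] by auto
  \<comment> \<open>A second label outside \<open>N\<close>, so that the pairs \<open>(b, z)\<close>
    and \<open>(x, s)\<close> are disjoint.\<close>
  then obtain z where z: "z \<in> U - N" "z \<noteq> s" by blast
  note bz = bN(1) z(1) x s
  have bU: "b \<in> U" "z \<in> U" "b \<noteq> z" using bz N by auto
  let ?U = "U - {b, z}" and ?W = "derived b z V"
  have W: "swap_system ?U ?W" by (rule derived_swap_system[OF V bU])
  have genW: "generated ?U ?W (d - 1)" by (rule derived_generated[OF V bU gen])
  have annW: "annihilated ?U ?W (Suc k)" by (rule derived_annihilated[OF V bU ann])
  have cU: "card ?U = card U - 2" using bU finU by (simp add: card_Diff_subset)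
  have cN: "card (N - {b}) = card N - 1" "card (N - {b} - {x}) = card N - 2"
    using bN x finN by (simp_all add: card_Diff_singleton)
  have sub: "N - {b} \<subseteq> ?U" "N - {b} - {x} \<subseteq> ?U" using N z by auto
  have qN: "q \<in> V N" using q del_span_subset[OF V N] by blast
  have qc: "q \<in> carrier G" using qN swap_system_carrier[OF V N] by blast
  have mem: "x \<in> \<Omega>" "s \<in> \<Omega>" "b \<in> \<Omega>" "z \<in> \<Omega>" using bz N U\<Omega> by auto
  have Ebz: "endo (J b z)" and Exs: "endo (J x s)" using J_endo mem by auto
  \<comment> \<open>The element \<open>w\<close> belongs to the derived system and is still killed
    by \<open>J x s\<close>. The induction hypothesis for the single pair \<open>(x, s)\<close>, in
    rank \<open>card N - 1\<close>, therefore removes \<open>x\<close> from its support.\<close>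
  define w where "w = J b z q"
  have insN: "insert b (N - {b}) = N" using bN by blast
  have wW: "w \<in> ?W (N - {b})" unfolding derived_def w_def insN using qN by blast
  have "J x s w = J b z (J x s q)"
    unfolding w_def by (rule J_J_commute) (use bz z bN mem qc in auto)
  then have Jw: "J x s w = \<zero>" using Jq endo_zero[OF Ebz] by simp
  have "w \<in> del_span ?W (N - {b}) (fst ` set [(x, s)])"
  proof (rule kernel_spannedD[OF IH W genW annW sub(1)])
    show "k + (d - 1) < card (N - {b})" "2 * card (N - {b}) < card ?U"
      using cardN cardU cN cU d by auto
    show "disjoint_pairs ?U [(x, s)]" using bz bN z N unfolding disjoint_pairs_def by auto
  qed (use bz bN z N wW Jw in auto)
  then have wx: "w \<in> ?W (N - {b} - {x})" using del_span_singleton[OF W sub(1)] by simp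
  \<comment> \<open>The size of \<open>U\<close> supplies partners for \<open>B\<close> outside
    \<open>N\<close> and different from \<open>z\<close>.\<close>
  have "card B \<le> card (N - {x, b})" by (rule card_mono[OF _ bN(3)]) (use finN in simp)
  also have "\<dots> \<le> card (U - N) - 1" using cardUN cardU card_mono[OF finN, of "N - {x, b}"] by auto
  also have "\<dots> = card (U - N - {z})" using z finU by (simp add: card_Diff_singleton)
  finally have cB: "card B \<le> card (U - N - {z})" .
  have finBC: "finite B" "finite (U - N - {z})" and disj: "B \<inter> (U - N - {z}) = {}"
    using bN(3) finN finU finite_subset by auto
  obtain ps where ps: "disjoint_pairs (B \<union> (U - N - {z})) ps" "fst ` set ps = B"
    "snd ` set ps \<subseteq> U - N - {z}"
    by (rule ex_disjoint_pairs[OF finBC cB disj])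
  have ps': "disjoint_pairs ?U ps"
    by (rule disjoint_pairs_mono[OF ps(1)]) (use bN N z in auto)
  \<comment> \<open>The first entries of this list form \<open>insert b B\<close>, so the easy
    inclusion shows that its product kills \<open>q\<close>. Hence the product over
    \<open>ps\<close> alone kills \<open>w\<close>.\<close>
  have "disjoint_pairs U ((b, z) # ps)"
    using ps' bU unfolding disjoint_pairs_def by auto
  then have "Jprod ((b, z) # ps) q = \<zero>"
    by (rule Jprod_vanish[OF V N]) (use ps(2,3) bN z q in auto)
  moreover have "Jprod ps w = J b z (Jprod ps q)"
    unfolding w_def
    by (rule Jprod_J_commute) (use mem qc ps' U\<Omega> in \<open>auto simp: disjoint_pairs_def\<close>)
  ultimately have Jpw: "Jprod ps w = \<zero>" by simp
  \<comment> \<open>Second use of the induction hypothesis, now in rank \<open>card N - 2\<close>.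
    Two points have been lost from \<open>N\<close>, and \<open>0 < d\<close> lets the drop of the
    degree to \<open>d - 1\<close> compensate for the second.\<close>
  have "w \<in> del_span ?W (N - {b} - {x}) (fst ` set ps)"
  proof (rule kernel_spannedD[OF IH W genW annW sub(2) _ _ ps' _ _ wx Jpw])
    show "k + (d - 1) < card (N - {b} - {x})" "2 * card (N - {b} - {x}) < card ?U"
      using cardN cardU cN cU d by auto
    show "fst ` set ps \<subseteq> N - {b} - {x}" using ps(2) bN(3) by blast
    show "snd ` set ps \<subseteq> ?U - (N - {b} - {x})" using ps(3) bN(1) by blast
  qed
  then have "w \<in> del_span ?W (N - {b} - {x}) B" using ps(2) by simp
  moreover have "B \<subseteq> N - {b} - {x}" using bN(3) by blast
  ultimately obtain u where u: "u \<in> del_span V (insert b (N - {b} - {x})) B" "w = J b z u"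
    using derived_del_span[OF V bU sub(2)] by metis
  have "insert b (N - {b} - {x}) = N - {x}" using bN by blast
  then have ux: "u \<in> del_span V (N - {x}) B" using u(1) by simp
  have xU: "N - {x} \<subseteq> U" using N by blast
  have uVx: "u \<in> V (N - {x})" using ux del_span_subset[OF V xU] by blast
  have "V (N - {x} - {i}) \<subseteq> del_span V N B" if "i \<in> B" for i
  proof -
    have "V (N - {x} - {i}) \<subseteq> V (N - {i})"
      by (rule swap_systemD(4)[OF V _ order_trans[OF Diff_subset N]]) blast
    then show ?thesis using del_span_incl[OF that] by (rule order_trans)
  qed
  then have "del_span V (N - {x}) B \<subseteq> del_span V N B"
    unfolding del_span_def[of V "N - {x}"]
    by (intro aspan_least[OF del_span_subgroup[OF V N]]) blast
  then have uB: "u \<in> del_span V N B" using ux by blast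
  have uN: "u \<in> V N" using uB del_span_subset[OF V N] by blast
  have uc: "u \<in> carrier G" using uN swap_system_carrier[OF V N] by blast
  define r where "r = q \<ominus> u"
  have rN: "r \<in> V N" unfolding r_def by (rule additive_subgroup_minus[OF swap_systemD(3)[OF V N] qN uN])
  have rc: "r \<in> carrier G" using rN swap_system_carrier[OF V N] by blast
  have "J b z r = w \<ominus> J b z u" unfolding r_def w_def by (rule endo_minus[OF Ebz qc uc])
  then have "J b z r = \<zero>" using u(2) minus_eq_zero_iff endo_closed[OF Ebz uc] by simp
  then have t1: "tau b z r = r" using J_eq_zero_iff mem rc by simp
  \<comment> \<open>\<open>u\<close> is supported away from \<open>x\<close> and \<open>s\<close>,
    so subtracting it from \<open>q\<close> preserves the kernel condition.\<close>
  have "J x s u = \<zero>" by (rule J_vanish[OF V xU _ _ uVx]) (use bz N in auto)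
  moreover have "J x s r = J x s q \<ominus> J x s u" unfolding r_def by (rule endo_minus[OF Exs qc uc])
  ultimately have "J x s r = \<zero>" using Jq by (simp add: minus_eq)
  then have t2: "tau x s r = r" using J_eq_zero_iff mem rc by simp
  \<comment> \<open>Both \<open>z\<close> and \<open>s\<close> lie outside \<open>N\<close>.
    Conjugating \<open>(b z)\<close> by \<open>(z s)\<close> gives \<open>(b s)\<close>, and
    conjugating \<open>(b s)\<close> by \<open>(x s)\<close> gives \<open>(b x)\<close>; each of
    these fixes \<open>r\<close>.\<close>
  have t3: "tau z s r = r" by (rule swap_systemD(6)[OF V N _ _ rN]) (use z s in auto)
  have "tau z s (tau b z r) = tau b s (tau z s r)"
    using tau_conj[OF mem(4,2,3,4) rc] bz bN by (auto simp: transpose_def split: if_splits)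
  then have t4: "tau b s r = r" using t1 t3 by simp
  have "tau x s (tau b s r) = tau b x (tau x s r)"
    using tau_conj[OF mem(1,2,3,2) rc] bz bN by (auto simp: transpose_def split: if_splits)
  then have t5: "tau b x r = r" using t2 t4 by simp
  have D: "additive_subgroup (del_span V N C) G" for C by (rule del_span_subgroup[OF V N])
  have mono: "del_span V N B \<subseteq> del_span V N (insert b B)" "del_span V N B \<subseteq> del_span V N (insert x B)"
    by (intro del_span_mono; blast)+
  have rD: "r \<in> del_span V N (insert b B)"
    unfolding r_def by (rule additive_subgroup_minus[OF D q subsetD[OF mono(1) uB]])
  have "tau b x r \<in> del_span V N (insert x B)"
  proof (rule endo_aspan_into[OF tau_endo[OF mem(3,1)] D del_carrier[OF V N]])
    show "r \<in> aspan (\<Union>c\<in>insert b B. V (N - {c}))" using rD by (simp only: del_span_def)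
    fix y assume "y \<in> (\<Union>c\<in>insert b B. V (N - {c}))"
    then obtain c where c: "c \<in> insert b B" "y \<in> V (N - {c})" by blast
    let ?c = "transpose b x c"
    have "tau b x y \<in> V (transpose b x ` (N - {c}))"
      by (rule swap_systemD(5)[OF V _ _ _ c(2)]) (use bz N in blast)+
    moreover have "transpose b x ` (N - {c}) = N - {?c}"
      using bz by (simp add: image_set_diff[OF inj_transpose])
    moreover have "?c \<in> insert x B" using c(1) bN by (auto simp: transpose_def)
    ultimately show "tau b x y \<in> del_span V N (insert x B)"
      using del_span_incl[of ?c "insert x B" V N] by auto
  qed
  then have "r \<in> del_span V N (insert x B)" using t5 by simp
  then have "u \<oplus> r \<in> del_span V N (insert x B)"
    by (rule additive_subgroup.a_closed[OF D subsetD[OF mono(2) uB]])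
  moreover have "u \<oplus> r = q" unfolding r_def by (rule plus_minus_cancel[OF uc qc])
  ultimately show ?thesis by simp
qed

text \<open>Eliminates the points of \<open>B\<close> one at a time. The component of
  \<open>v\<close> in \<open>V (N - {x})\<close> is killed by \<open>J x s\<close>, so the remainder
  is killed too, and \<open>exchange\<close> trades its summand at \<open>b\<close> for one at
  \<open>x\<close>.\<close>

lemma single_of_del_span:
  assumes "finite B" "B \<subseteq> N - {x}" "v \<in> del_span V N (insert x B)" "J x s v = \<zero>"
  shows "v \<in> V (N - {x})"
  using assms
proof (induction B arbitrary: v rule: finite_induct)
  case empty
  then show ?case using del_span_singleton[OF V N] by simp
next
  case (insert b B)
  obtain p q where p: "p \<in> V (N - {x})" and q: "q \<in> del_span V N (insert b B)" and v: "v = p \<oplus> q"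
    by (rule del_span_insert[OF V N insert.prems(2)])
  have xU: "N - {x} \<subseteq> U" using N by blast
  have pc: "p \<in> carrier G" using p swap_system_carrier[OF V xU] by blast
  have qN: "q \<in> V N" using q del_span_subset[OF V N] by blast
  have qc: "q \<in> carrier G" using qN swap_system_carrier[OF V N] by blast
  have "x \<in> \<Omega>" "s \<in> \<Omega>" using x s N swap_systemD(2)[OF V] by auto
  then have E: "endo (J x s)" by (rule J_endo)
  have "J x s p = \<zero>" by (rule J_vanish[OF V xU _ _ p]) (use x s N in auto)
  moreover have "J x s v = J x s p \<oplus> J x s q" unfolding v using E pc qc by (simp add: endo_def)
  ultimately have "J x s q = \<zero>" using insert.prems(3) endo_closed[OF E qc] by simp
  then have q': "q \<in> del_span V N (insert x B)"
    by (rule exchange[OF insert.prems(1) insert.hyps(2) q])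
  have "p \<in> del_span V N (insert x B)" using del_span_incl[of x "insert x B" V N] p by blast
  then have "v \<in> del_span V N (insert x B)"
    unfolding v using q' by (rule additive_subgroup.a_closed[OF del_span_subgroup[OF V N]])
  then show ?case by (rule insert.IH[rotated]) (use insert.prems in auto)
qed

end

text \<open>\<open>cover\<close> spreads \<open>v\<close> over \<open>x\<close> and \<open>k\<close>
  further deletions, and \<open>single_of_del_span\<close> then removes the latter. For
  \<open>k = 0\<close>, \<open>cover\<close> at \<open>x\<close> alone suffices.\<close>

lemma single:
  assumes V: "swap_system U V" and gen: "generated U V d" and ann: "annihilated U V (Suc k)"
    and N: "N \<subseteq> U" and cardN: "k + d < card N" and cardU: "2 * card N < card U"
    and x: "x \<in> N" and s: "s \<in> U - N" and IH: "\<And>j. k = Suc j \<Longrightarrow> kernel_spanned j"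
    and v: "v \<in> V N" "J x s v = \<zero>"
  shows "v \<in> V (N - {x})"
proof -
  have finN: "finite N" using N swap_systemD(1)[OF V] finite_subset by blast
  have cover': "v \<in> del_span V N B" if "B \<subseteq> N" "card B = Suc k" for B
    by (rule subsetD[OF cover[OF V gen ann N _ that] v(1)]) (use cardN in simp)
  show ?thesis
  proof (cases k)
    case 0
    then show ?thesis using cover'[of "{x}"] x del_span_singleton[OF V N] by simp
  next
    case (Suc j)
    show ?thesis
    proof (cases "d = 0")
      case True
      \<comment> \<open>In degree zero everything comes from \<open>V {}\<close>, which lies in
        every summand. This case is split off because the degree cannot drop further, and the count
        in rank \<open>card N - 2\<close> could fail.\<close>
      have eq: "{S. S \<subseteq> N \<and> card S \<le> d} = {{}}"
        using finN True finite_subset by (auto simp: card_eq_0_iff)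
      have xU: "N - {x} \<subseteq> U" using N by blast
      have "V N \<subseteq> aspan (V {})" using span_small[OF V gen N] unfolding eq by simp
      also have "\<dots> \<subseteq> V (N - {x})"
        by (intro aspan_least swap_systemD(3)[OF V xU] swap_systemD(4)[OF V _ xU]) blast
      finally show ?thesis using v by blast
    next
      case False
      have "k \<le> card (N - {x})" using cardN x finN by (simp add: card_Diff_singleton)
      then obtain B where B: "B \<subseteq> N - {x}" "card B = k" "finite B"
        by (meson obtain_subset_with_card_n)
      then have "insert x B \<subseteq> N" "card (insert x B) = Suc k" using x by (auto simp: card_insert_if)
      then have "v \<in> del_span V N (insert x B)" by (rule cover')
      with B v(2) show ?thesis
        by (intro single_of_del_span[OF V gen _ N _ cardU x s IH[OF Suc]]) (use ann cardN Suc False in auto)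
    qed
  qed
qed

section \<open>The kernel of a product, by strong induction\<close>

lemma kernel_spanned: "kernel_spanned k"
proof (induction k rule: less_induct)
  case (less k)
  show ?case
    unfolding kernel_spanned_def
  proof (intro allI impI)
    fix U V d N ps v
    assume V: "swap_system U V" and gen: "generated U V d" and ann: "annihilated U V (Suc k)"
      and N: "N \<subseteq> U" and cardN: "k + d < card N" and cardU: "2 * card N < card U"
      and ps: "disjoint_pairs U ps" and fst: "fst ` set ps \<subseteq> N" and snd: "snd ` set ps \<subseteq> U - N"
      and v: "v \<in> V N" and Jv: "Jprod ps v = \<zero>"
    have finN: "finite N" using N swap_systemD(1)[OF V] finite_subset by blast
    have finU: "finite U" by (rule swap_systemD(1)[OF V])
    have vc: "v \<in> carrier G" using v swap_system_carrier[OF V N] by blast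
    show "v \<in> del_span V N (fst ` set ps)"
    proof (cases ps)
      case Nil
      then show ?thesis
        using Jv additive_subgroup.zero_closed[OF del_span_subgroup[OF V N]] by simp
    next
      case (Cons p qs)
      obtain a s where p: "p = (a, s)" by (cases p)
      have as: "a \<in> N" "s \<in> U - N" using fst snd Cons p by auto
      have aU: "a \<in> U" "s \<in> U" "a \<noteq> s" using as N by auto
      have single: "u \<in> V (N - {a})" if "u \<in> V N" "J a s u = \<zero>" for u
        by (rule single[OF V gen ann N cardN cardU as]) (use less that in auto)
      have D: "additive_subgroup (del_span V N (fst ` set ps)) G" by (rule del_span_subgroup[OF V N])
      have aD: "V (N - {a}) \<subseteq> del_span V N (fst ` set ps)"
        by (rule del_span_incl) (simp add: Cons p)
      show ?thesis
      proof (cases k)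
        case 0
        \<comment> \<open>Here a single factor already annihilates, so the deletion at
          \<open>a\<close> covers all of \<open>V N\<close>.\<close>
        have "V N \<subseteq> del_span V N {a}"
          by (rule cover[OF V gen ann N]) (use 0 cardN as in auto)
        then show ?thesis using v aD del_span_singleton[OF V N] by auto
      next
        case (Suc j)
        let ?U = "U - {a, s}" and ?W = "derived a s V"
        have psD: "disjoint_pairs ?U qs" using disjoint_pairsD[of U p qs] ps Cons p by simp
        have sub: "N - {a} \<subseteq> ?U" using N as by auto
        have \<Omega>: "U \<subseteq> \<Omega>" by (rule swap_systemD(2)[OF V])
        have insN: "insert a (N - {a}) = N" using as by blast
        have E: "endo (J a s)" by (rule J_endo) (use aU \<Omega> in auto)
        \<comment> \<open>Moving \<open>J a s\<close> inside exhibits \<open>J a s v\<close> as an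
          element of the derived system killed by the product over \<open>qs\<close>.\<close>
        have "Jprod qs (J a s v) = J a s (Jprod qs v)"
          by (rule Jprod_J_commute) (use aU \<Omega> psD vc in \<open>auto simp: disjoint_pairs_def\<close>)
        then have Jw: "Jprod qs (J a s v) = \<zero>" using Jv Cons p by simp
        have wW: "J a s v \<in> ?W (N - {a})" unfolding derived_def insN using v by blast
        have qs: "fst ` set qs \<subseteq> N - {a}" "snd ` set qs \<subseteq> ?U - (N - {a})"
          using fst snd Cons psD unfolding disjoint_pairs_def by auto
        have "J a s v \<in> del_span ?W (N - {a}) (fst ` set qs)"
        proof (rule kernel_spannedD[OF less.IH[of j] derived_swap_system[OF V aU]
              derived_generated[OF V aU gen] derived_annihilated[OF V aU] sub _ _ psD qs wW Jw])
          show "j < k" "annihilated U V (Suc (Suc j))" using Suc ann by auto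
          have cN: "card (N - {a}) = card N - 1" using as finN by (simp add: card_Diff_singleton)
          have cU: "card ?U = card U - 2" using aU finU by (simp add: card_Diff_subset)
          show "j + (d - 1) < card (N - {a})" using cN cardN Suc by auto
          show "2 * card (N - {a}) < card ?U" using cN cU cardN cardU by auto
        qed
        then obtain u where u: "u \<in> del_span V N (fst ` set qs)" "J a s v = J a s u"
          using derived_del_span[OF V aU sub qs(1)] insN by metis
        have uN: "u \<in> V N" using u(1) del_span_subset[OF V N] by blast
        have uc: "u \<in> carrier G" using uN swap_system_carrier[OF V N] by blast
        \<comment> \<open>The lift \<open>u\<close> accounts for the pairs in \<open>qs\<close>.
          What remains is killed by the one factor \<open>J a s\<close>, so \<open>single\<close>
          places it in \<open>V (N - {a})\<close>.\<close>
        have "J a s (v \<ominus> u) = \<zero>"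
          using endo_minus[OF E vc uc] u(2) endo_closed[OF E uc] minus_eq_zero_iff by simp
        moreover have "v \<ominus> u \<in> V N"
          by (rule additive_subgroup_minus[OF swap_systemD(3)[OF V N] v uN])
        ultimately have "v \<ominus> u \<in> del_span V N (fst ` set ps)" using single aD by blast
        moreover have "u \<in> del_span V N (fst ` set ps)"
          by (rule subsetD[OF del_span_mono u(1)]) (auto simp: Cons)
        ultimately have "u \<oplus> (v \<ominus> u) \<in> del_span V N (fst ` set ps)"
          by (rule additive_subgroup.a_closed[OF D, rotated])
        then show ?thesis using plus_minus_cancel[OF uc vc] by simp
      qed
    qed
  qed
qed

end

subsection \<open>The subgroups of a torsion-free FI-module\<close>

lemma zcomp_diff_left:
  "zcomp S T U (\<lambda>g. y g - y' g) x = (\<lambda>h. zcomp S T U y x h - zcomp S T U y' x h)"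
  by (simp add: zcomp_def case_prod_beta left_diff_distrib sum_subtractf)

text \<open>As \<open>g\<close> is its own inverse, \<open>compose S g h\<close> is the unique
  injection that \<open>g\<close> carries to \<open>h\<close>.\<close>

lemma zcomp_zsingle_left:
  assumes "finite S" "finite T" "g \<in> fi_hom T T" "compose T g g = fi_incl T" "h \<in> fi_hom S T"
  shows "zcomp S T T (zsingle g) x h = x (compose S g h)"
proof -
  have inv: "compose S g (compose S g f) = f" if "f \<in> fi_hom S T" for f
    using fi_compose_assoc[OF that assms(3), of g] fi_compose_id_left[OF that] assms(4) by simp
  have "zcomp S T T (zsingle g) x h =
    (\<Sum>g'\<in>fi_hom T T. if g' = g then (\<Sum>f\<in>fi_hom S T. if compose S g f = h then x f else 0) else 0)"
    using assms(1,2) by (auto simp: zcomp_eq_if zsingle_def intro!: sum.cong sum.neutral)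
  also have "\<dots> = (\<Sum>f\<in>fi_hom S T. if compose S g f = h then x f else 0)"
    using assms finite_fi_hom by simp
  also have "\<dots> = (\<Sum>f\<in>fi_hom S T. if f = compose S g h then x f else 0)"
    using inv assms(5) by (intro sum.cong refl) auto
  also have "\<dots> = x (compose S g h)"
    using fi_compose_in[OF assms(5,3)] assms(1,2) finite_fi_hom by simp
  finally show ?thesis .
qed

lemma J_prod_Nil: "J_prod T [] = zsingle (fi_incl T)"
  by (simp add: J_prod_def zgroup_ring_def)

lemma J_prod_Cons: "J_prod T (p # ps) = zcomp T T T (J_elt T (fst p) (snd p)) (J_prod T ps)"
  by (simp add: J_prod_def zgroup_ring_def case_prod_beta)

text \<open>Conjugation of a transposition by an injection, in a form free of inverses. Injectivity
  of \<open>e\<close> ensures that points other than \<open>i\<close> and \<open>j\<close> avoid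
  \<open>e i\<close> and \<open>e j\<close>.\<close>

lemma fi_compose_transpose:
  assumes "e \<in> fi_hom T U" "i \<in> T" "j \<in> T"
  shows "compose T e (restrict (transpose i j) T) = compose T (restrict (transpose (e i) (e j)) U) e"
  using assms
  by (auto simp: fi_hom_def compose_def transpose_def fun_eq_iff inj_on_def PiE_def Pi_iff)

lemma fi_hom_superset: "f \<in> fi_hom S T \<Longrightarrow> T \<subseteq> U \<Longrightarrow> f \<in> fi_hom S U"
  by (auto simp: fi_hom_def PiE_def Pi_iff)

text \<open>The infimum is below \<open>n\<close>, so some admissible bound is already below
  \<open>n\<close>.\<close>

lemma fi_degree_lessD:
  assumes "fi_degree W \<le> ereal (real d)" "d < n"
  shows "carrier (W {1..n}) = {\<zero>\<^bsub>W {1..n}\<^esub>}"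
proof -
  have "fi_degree W < ereal (real n)"
    by (rule le_less_trans[OF assms(1)]) (simp add: assms(2))
  then obtain k where "k < ereal (real n)" "\<forall>n::nat. ereal (real n) > k \<longrightarrow> carrier (W {1..n}) = {\<zero>\<^bsub>W {1..n}\<^esub>}"
    unfolding fi_degree_def Inf_less_iff by blast
  then show ?thesis by blast
qed

context FI_module
begin

section \<open>Induced maps as homomorphisms and the action of transpositions\<close>

lemma abelian: "finite T \<Longrightarrow> abelian_group (V T)"
  using obj_module by (simp add: module_def)

lemma F_hom:
  assumes "finite S" "finite T" "f \<in> fi_hom S T"
  shows "abelian_group_hom (V S) (V T) (F S T f)"
proof (rule abelian_group_homI)
  interpret S: abelian_group "V S" by (rule abelian[OF assms(1)])
  interpret T: abelian_group "V T" by (rule abelian[OF assms(2)])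
  have "F S T f \<in> hom (add_monoid (V S)) (add_monoid (V T))"
    using map_hom[OF assms] by (auto simp: module_hom_def hom_def)
  then show "group_hom (add_monoid (V S)) (add_monoid (V T)) (F S T f)"
    using S.a_group T.a_group by (simp add: group_hom_def group_hom_axioms_def)
qed (use abelian assms in auto)

lemma F_closed:
  "finite S \<Longrightarrow> finite T \<Longrightarrow> f \<in> fi_hom S T \<Longrightarrow> v \<in> carrier (V S) \<Longrightarrow> F S T f v \<in> carrier (V T)"
  by (rule abelian_group_hom.hom_closed[OF F_hom])

lemmas F_minus = abelian_group_hom.hom_minus[OF F_hom]

definition tau :: "nat set \<Rightarrow> nat \<Rightarrow> nat \<Rightarrow> 'a \<Rightarrow> 'a" where
  "tau T i j = F T T (restrict (transpose i j) T)"

lemma tau_tau: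
  assumes "finite T" "{i, j, k, l} \<subseteq> T" "v \<in> carrier (V T)"
  shows "tau T i j (tau T k l v) = F T T (restrict (transpose i j \<circ> transpose k l) T) v"
proof -
  have "compose T (restrict (transpose i j) T) (restrict (transpose k l) T) =
    restrict (transpose i j \<circ> transpose k l) T"
    using assms(2) by (auto simp: compose_def fun_eq_iff transpose_def)
  then show ?thesis
    using map_comp[OF assms(1) assms(1) assms(1) fi_transpose_in[of k T l] fi_transpose_in[of i T j] assms(3)]
      assms(2) by (simp add: tau_def)
qed

lemma swap_action:
  assumes T: "finite T"
  shows "swap_action (V T) (tau T) T"
proof -
  interpret abelian_group "V T" by (rule abelian[OF T])
  show ?thesis
  proof
    fix i j assume ij: "i \<in> T" "j \<in> T"
    interpret h: abelian_group_hom "V T" "V T" "tau T i j"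
      unfolding tau_def by (rule F_hom[OF T T fi_transpose_in[OF ij]])
    show "endo (tau T i j)" unfolding endo_def by simp
    show "tau T i j = tau T j i" by (simp add: tau_def transpose_commute)
    fix k l v assume kl: "k \<in> T" "l \<in> T" "v \<in> carrier (V T)"
    let ?t = "transpose i j"
    have "?t \<circ> transpose k l = transpose (?t k) (?t l) \<circ> ?t"
      by (auto simp: fun_eq_iff transpose_def)
    moreover have "?t k \<in> T" "?t l \<in> T" using ij kl by (auto simp: transpose_def)
    ultimately show "tau T i j (tau T k l v) = tau T (?t k) (?t l) (tau T i j v)"
      using ij kl by (simp add: tau_tau[OF T])
  qed
qed

section \<open>The action of formal combinations on an FI-module\<close>

lemma zact_closed:
  assumes "finite S" "finite T" "v \<in> carrier (V S)"
  shows "zact V F S T x v \<in> carrier (V T)"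
proof -
  interpret module \<Z> "V T" by (rule obj_module[OF assms(2)])
  show ?thesis unfolding zact_def using assms F_closed by (intro M.finsum_closed) auto
qed

lemma zact_diff:
  assumes fin: "finite S" "finite T" and v: "v \<in> carrier (V S)"
  shows "zact V F S T (\<lambda>f. x f - y f) v = zact V F S T x v \<ominus>\<^bsub>V T\<^esub> zact V F S T y v"
proof -
  interpret module \<Z> "V T" by (rule obj_module[OF fin(2)])
  have F: "F S T f v \<in> carrier (V T)" if "f \<in> fi_hom S T" for f using F_closed fin v that by blast
  have "zact V F S T x v = (\<Oplus>\<^bsub>V T\<^esub>f\<in>fi_hom S T.
      y f \<odot>\<^bsub>V T\<^esub> F S T f v \<oplus>\<^bsub>V T\<^esub> (x f - y f) \<odot>\<^bsub>V T\<^esub> F S T f v)"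
    unfolding zact_def
  proof (intro M.finsum_cong' refl)
    fix f assume f: "f \<in> fi_hom S T"
    show "x f \<odot>\<^bsub>V T\<^esub> F S T f v = y f \<odot>\<^bsub>V T\<^esub> F S T f v \<oplus>\<^bsub>V T\<^esub> (x f - y f) \<odot>\<^bsub>V T\<^esub> F S T f v"
      using smult_l_distr[of "y f" "x f - y f" "F S T f v"] F[OF f] by simp
  qed (use F in auto)
  also have "\<dots> = zact V F S T y v \<oplus>\<^bsub>V T\<^esub> zact V F S T (\<lambda>f. x f - y f) v"
    unfolding zact_def using F by (intro M.finsum_addf) auto
  finally show ?thesis
    using zact_closed[OF fin v, of y] zact_closed[OF fin v, of "\<lambda>f. x f - y f"]
    by (simp add: M.minus_eq M.a_ac M.r_neg2 M.r_neg1)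
qed

lemma zact_zsingle:
  assumes "finite S" "finite T" "f \<in> fi_hom S T" "v \<in> carrier (V S)"
  shows "zact V F S T (zsingle f) v = F S T f v"
proof -
  interpret module \<Z> "V T" by (rule obj_module[OF assms(2)])
  have F: "F S T g v \<in> carrier (V T)" if "g \<in> fi_hom S T" for g using F_closed assms that by blast
  have "zact V F S T (zsingle f) v =
    (\<Oplus>\<^bsub>V T\<^esub>g\<in>fi_hom S T. if f = g then F S T g v else \<zero>\<^bsub>V T\<^esub>)"
    unfolding zact_def
    by (intro M.finsum_cong' refl) (use F smult_one smult_l_null in \<open>auto simp: zsingle_def\<close>)
  also have "\<dots> = F S T f v"
    using assms finite_fi_hom F by (intro M.finsum_singleton) auto
  finally show ?thesis .
qed

text \<open>Composition with the involution \<open>g\<close> permutes \<open>fi_hom S T\<close>.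
  Reindexing the sum along it and using functoriality pulls \<open>F T T g\<close> out.\<close>

lemma zact_zcomp_zsingle:
  assumes fin: "finite S" "finite T" and g: "g \<in> fi_hom T T" "compose T g g = fi_incl T"
    and v: "v \<in> carrier (V S)"
  shows "zact V F S T (zcomp S T T (zsingle g) x) v = F T T g (zact V F S T x v)"
proof -
  interpret module \<Z> "V T" by (rule obj_module[OF fin(2)])
  interpret h: abelian_group_hom "V T" "V T" "F T T g" by (rule F_hom[OF fin(2,2) g(1)])
  let ?A = "fi_hom S T" and ?\<sigma> = "compose S g"
  have F: "F S T f v \<in> carrier (V T)" if "f \<in> fi_hom S T" for f using F_closed fin v that by blast
  have in': "?\<sigma> f \<in> ?A" if "f \<in> ?A" for f by (rule fi_compose_in[OF that g(1)])
  have inv: "?\<sigma> (?\<sigma> f) = f" if "f \<in> ?A" for f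
    using fi_compose_assoc[OF that g(1), of g] fi_compose_id_left[OF that] g(2) by simp
  have inj: "inj_on ?\<sigma> ?A" using inv by (metis inj_onI)
  have img: "?\<sigma> ` ?A = ?A" using in' inv by (metis image_eqI image_subsetI subsetI subset_antisym)
  have "zact V F S T (zcomp S T T (zsingle g) x) v =
    (\<Oplus>\<^bsub>V T\<^esub>f\<in>?\<sigma> ` ?A. x (?\<sigma> f) \<odot>\<^bsub>V T\<^esub> F S T f v)"
    unfolding zact_def img
    by (intro M.finsum_cong' refl) (use F zcomp_zsingle_left[OF fin g] in auto)
  also have "\<dots> = (\<Oplus>\<^bsub>V T\<^esub>f\<in>?A. x (?\<sigma> (?\<sigma> f)) \<odot>\<^bsub>V T\<^esub> F S T (?\<sigma> f) v)"
    by (rule M.finsum_reindex[OF _ inj]) (use F img in auto)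
  also have "\<dots> = (\<Oplus>\<^bsub>V T\<^esub>f\<in>?A. F T T g (x f \<odot>\<^bsub>V T\<^esub> F S T f v))"
  proof (intro M.finsum_cong' refl)
    fix f assume f: "f \<in> ?A"
    have "F T T g (x f \<odot>\<^bsub>V T\<^esub> F S T f v) = x f \<odot>\<^bsub>V T\<^esub> F T T g (F S T f v)"
      using map_hom[OF fin(2,2) g(1)] F[OF f] by (simp add: module_hom_def)
    then show "x (?\<sigma> (?\<sigma> f)) \<odot>\<^bsub>V T\<^esub> F S T (?\<sigma> f) v = F T T g (x f \<odot>\<^bsub>V T\<^esub> F S T f v)"
      using inv[OF f] map_comp[OF fin fin(2) f g(1) v] by simp
  qed (use F in auto)
  also have "\<dots> = F T T g (zact V F S T x v)"
    unfolding zact_def using F finite_fi_hom[OF fin] by (intro h.hom_finsum[symmetric]) auto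
  finally show ?thesis .
qed

definition Jact :: "nat set \<Rightarrow> (nat \<times> nat) list \<Rightarrow> 'a \<Rightarrow> 'a" where
  "Jact T = swap_action.Jprod (V T) (tau T)"

lemma Jact_Nil: "finite T \<Longrightarrow> Jact T [] v = v"
  unfolding Jact_def by (rule swap_action.Jprod_Nil[OF swap_action])

lemma Jact_Cons:
  "finite T \<Longrightarrow> Jact T (p # ps) v = Jact T ps v \<ominus>\<^bsub>V T\<^esub> tau T (fst p) (snd p) (Jact T ps v)"
  unfolding Jact_def
  by (simp add: swap_action.Jprod_Cons[OF swap_action] swap_action.J_def[OF swap_action])

lemma Jact_closed:
  assumes "finite T" "fst ` set ps \<union> snd ` set ps \<subseteq> T" "v \<in> carrier (V T)"
  shows "Jact T ps v \<in> carrier (V T)"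
  unfolding Jact_def
  by (rule abelian_group.endo_closed[OF abelian swap_action.Jprod_endo[OF swap_action]])
    (use assms in auto)

text \<open>Links the formal products in the hypothesis and in \<open>J_tilde\<close> with
  composites of operators. Each factor is the identity minus an involution, so
  \<open>zact_diff\<close> and \<open>zact_zcomp_zsingle\<close> evaluate it.\<close>

lemma zact_J_prod:
  assumes fin: "finite S" "finite T" and ps: "fst ` set ps \<union> snd ` set ps \<subseteq> T"
    and x: "x \<in> zhom S T" and v: "v \<in> carrier (V S)"
  shows "zact V F S T (zcomp S T T (J_prod T ps) x) v = Jact T ps (zact V F S T x v)"
  using ps
proof (induction ps)
  case Nil
  then show ?case by (simp add: J_prod_Nil zcomp_id_left[OF fin x] Jact_Nil[OF fin(2)])
next
  case (Cons p ps)
  let ?y = "zcomp S T T (J_prod T ps) x" and ?\<tau> = "restrict (transpose (fst p) (snd p)) T"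
  have y: "?y \<in> zhom S T" by (rule zcomp_in)
  have \<tau>: "?\<tau> \<in> fi_hom T T" using Cons.prems by (intro fi_transpose_in) auto
  have inv: "compose T ?\<tau> ?\<tau> = fi_incl T"
    using Cons.prems by (auto simp: compose_def fi_incl_def fun_eq_iff transpose_def)
  have "zcomp S T T (J_prod T (p # ps)) x = zcomp S T T (J_elt T (fst p) (snd p)) ?y"
    unfolding J_prod_Cons using fin by (simp add: zcomp_assoc)
  also have "\<dots> = (\<lambda>h. ?y h - zcomp S T T (zsingle ?\<tau>) ?y h)"
    unfolding J_elt_def zcomp_diff_left by (simp add: zcomp_id_left[OF fin y])
  finally show ?case
    using Cons by (simp add: zact_diff[OF fin v] zact_zcomp_zsingle[OF fin \<tau> inv v] tau_def Jact_Cons[OF fin(2)])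
qed

text \<open>Products of \<open>J\<close> are natural under relabelling, because an injection carries
  the transposition of \<open>i\<close> and \<open>j\<close> to that of their images.\<close>

lemma F_Jact:
  assumes fin: "finite T" "finite U" and e: "e \<in> fi_hom T U"
    and ps: "fst ` set ps \<union> snd ` set ps \<subseteq> T" and v: "v \<in> carrier (V T)"
  shows "F T U e (Jact T ps v) = Jact U (map (map_prod e e) ps) (F T U e v)"
  using ps
proof (induction ps)
  case Nil
  then show ?case by (simp add: Jact_Nil fin)
next
  case (Cons p ps)
  let ?\<tau> = "restrict (transpose (fst p) (snd p)) T"
    and ?\<tau>' = "restrict (transpose (e (fst p)) (e (snd p))) U"
  have p: "fst p \<in> T" "snd p \<in> T" using Cons.prems by auto
  then have ep: "e (fst p) \<in> U" "e (snd p) \<in> U" using e by (auto simp: fi_hom_def)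
  have c: "Jact T ps v \<in> carrier (V T)" using Cons.prems by (intro Jact_closed fin v) auto
  note \<tau> = fi_transpose_in[OF p] and \<tau>' = fi_transpose_in[OF ep]
  have "F T U e (F T T ?\<tau> (Jact T ps v)) = F U U ?\<tau>' (F T U e (Jact T ps v))"
    using map_comp[OF fin(1,1,2) \<tau> e c] map_comp[OF fin(1,2,2) e \<tau>' c] fi_compose_transpose[OF e p]
    by simp
  moreover have "F T T ?\<tau> (Jact T ps v) \<in> carrier (V T)" by (rule F_closed[OF fin(1,1) \<tau> c])
  ultimately show ?case
    using Cons c by (simp add: Jact_Cons fin F_minus[OF fin e] tau_def)
qed

section \<open>The subgroups \<open>V_T\<close> of one large \<open>V_U\<close> as a swap
  system\<close>

lemma lower_span_eq_carrier:
  assumes gen: "generated_in_degree_le V F d" and "d < n"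
  shows "carrier (V {1..n}) \<subseteq> lower_span V F {1..n}"
proof
  let ?M = "V {1..n}" and ?N = "lower_span V F {1..n}"
  interpret M: abelian_group ?M by (rule abelian) simp
  have eq: "a_rcosets\<^bsub>?M\<^esub> ?N = {?N}"
    using fi_degree_lessD[of "H0 V F" d n] assms
    by (simp add: generated_in_degree_le_def H0_def quot_module_def)
  fix x assume x: "x \<in> carrier ?M"
  then have "?N +>\<^bsub>?M\<^esub> x \<in> a_rcosets\<^bsub>?M\<^esub> ?N" by (auto simp: A_RCOSETS_def')
  then have N: "?N +>\<^bsub>?M\<^esub> x = ?N" using eq by simp
  \<comment> \<open>\<open>H_0\<close> vanishes, so \<open>?N\<close> is the only coset; since it
    contains zero, the coset of \<open>x\<close> contains \<open>x\<close>.\<close>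
  have "\<zero>\<^bsub>?M\<^esub> \<in> ?N" unfolding lower_span_def using generate.one[of "add_monoid ?M"] by simp
  then have "\<zero>\<^bsub>?M\<^esub> \<oplus>\<^bsub>?M\<^esub> x \<in> ?N +>\<^bsub>?M\<^esub> x" unfolding a_r_coset_def' by blast
  then show "x \<in> ?N" by (simp only: N M.l_zero[OF x])
qed

text \<open>A map with values in \<open>R\<close> factors through the inclusion of \<open>R\<close>
  in \<open>U\<close>.\<close>

lemma F_in_sub_image:
  assumes "finite S" "finite U" "h \<in> fi_hom S R" "R \<subseteq> U" "x \<in> carrier (V S)"
  shows "F S U h x \<in> sub_image V F R U"
proof -
  have R: "finite R" using assms finite_subset by blast
  have "F S U h x = F R U (fi_incl R) (F S R h x)"
    using map_comp[OF assms(1) R assms(2,3) fi_incl_in[OF assms(4)] assms(5)]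
      fi_compose_id_left[OF assms(3)] by simp
  then show ?thesis using F_closed[OF assms(1) R assms(3,5)] unfolding sub_image_def by blast
qed

lemma sub_image_subgroup:
  assumes "finite U" "R \<subseteq> U"
  shows "additive_subgroup (sub_image V F R U) (V U)"
proof -
  have R: "finite R" using assms finite_subset by blast
  interpret h: abelian_group_hom "V R" "V U" "F R U (fi_incl R)"
    by (rule F_hom[OF R assms(1) fi_incl_in[OF assms(2)]])
  have "additive_subgroup (carrier (V R)) (V R)" by (rule h.G.additive_subgroup_diffI) auto
  then show ?thesis unfolding sub_image_def by (rule h.additive_subgroup_image)
qed

lemma sub_image_swap_system:
  assumes U: "finite U"
  shows "swap_action.swap_system (V U) (tau U) U U (\<lambda>T. sub_image V F T U)"
  unfolding swap_action.swap_system_def[OF swap_action[OF U]]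
proof (intro conjI allI ballI impI subset_refl U)
  fix T assume T: "T \<subseteq> U"
  have fT: "finite T" using T U finite_subset by blast
  show "additive_subgroup (sub_image V F T U) (V U)" by (rule sub_image_subgroup[OF U T])
  show "sub_image V F S U \<subseteq> sub_image V F T U" if S: "S \<subseteq> T" for S
  proof
    fix v assume "v \<in> sub_image V F S U"
    then obtain x where x: "x \<in> carrier (V S)" "v = F S U (fi_incl S) x" unfolding sub_image_def by blast
    show "v \<in> sub_image V F T U" unfolding x(2)
      by (rule F_in_sub_image[OF finite_subset[OF S fT] U fi_incl_in[OF S] T x(1)])
  qed
  fix i j v assume i: "i \<in> U" and j: "j \<in> U" and "v \<in> sub_image V F T U"
  then obtain x where x: "x \<in> carrier (V T)" "v = F T U (fi_incl T) x" unfolding sub_image_def by blast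
  let ?t = "restrict (transpose i j) T"
  have t: "?t \<in> fi_hom T (transpose i j ` T)"
    by (auto simp: fi_hom_def inj_on_def transpose_eq_iff)
  have tU: "transpose i j ` T \<subseteq> U" using i j T by (auto simp: transpose_def)
  have "compose T (restrict (transpose i j) U) (fi_incl T) = ?t"
    using T by (auto simp: compose_def fi_incl_def fun_eq_iff)
  then have tv: "tau U i j v = F T U ?t x"
    unfolding x(2) tau_def
    using map_comp[OF fT U U fi_incl_in[OF T] fi_transpose_in[OF i j] x(1)] by simp
  show "tau U i j v \<in> sub_image V F (transpose i j ` T) U"
    unfolding tv by (rule F_in_sub_image[OF fT U t tU x(1)])
  assume "i \<notin> T" "j \<notin> T"
  then have "?t = fi_incl T" by (auto simp: fi_incl_def fun_eq_iff transpose_def)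
  then show "tau U i j v = v" using tv x(2) by simp
qed

lemma sub_image_generated:
  assumes U: "finite U" and gen: "generated_in_degree_le V F d"
  shows "swap_action.generated (V U) U (\<lambda>T. sub_image V F T U) d"
  unfolding swap_action.generated_def[OF swap_action[OF U]]
proof (intro allI impI)
  fix T assume T: "T \<subseteq> U" and d: "d < card T"
  interpret abelian_group "V U" by (rule abelian[OF U])
  let ?k = "card T" and ?X = "\<Union>t\<in>T. sub_image V F (T - {t}) U"
  have TU: "T - {t} \<subseteq> U" for t using T by blast
  have fT: "finite T" using T U finite_subset by blast
  have sg: "additive_subgroup (aspan ?X) (V U)"
    by (intro aspan_subgroup UN_least additive_subgroup.a_subset[OF sub_image_subgroup[OF U TU]])
  \<comment> \<open>The degree hypothesis concerns only the sets \<open>{1..n}\<close>, so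
    \<open>T\<close> is relabelled as \<open>{1..?k}\<close>.\<close>
  obtain g0 where g0: "bij_betw g0 {1..?k} T"
    using finite_same_card_bij[of "{1..?k}" T] fT by auto
  define g where "g = restrict g0 {1..?k}"
  define g' where "g' = restrict (inv_into {1..?k} g0) T"
  have g0': "bij_betw (inv_into {1..?k} g0) T {1..?k}" by (rule bij_betw_inv_into[OF g0])
  have g: "g \<in> fi_hom {1..?k} T" and g': "g' \<in> fi_hom T {1..?k}"
    using g0 g0' by (auto simp: fi_hom_def g_def g'_def bij_betw_def inj_on_restrict_eq)
  have gg: "compose T g g' = fi_incl T"
    using g0 g0' bij_betw_inv_into_right[OF g0]
    by (auto simp: compose_def fi_incl_def g_def g'_def fun_eq_iff bij_betw_def)
  have gU: "g \<in> fi_hom {1..?k} U" by (rule fi_hom_superset[OF g T])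
  interpret h: abelian_group_hom "V {1..?k}" "V U" "F {1..?k} U g" by (rule F_hom[OF _ U gU]) simp
  have "lower_span V F {1..?k} \<subseteq> {y \<in> carrier (V {1..?k}). F {1..?k} U g y \<in> aspan ?X}"
    unfolding lower_span_def h.G.aspan_def[symmetric]
  proof (rule h.G.aspan_least[OF h.additive_subgroup_preimage[OF sg]], clarify, intro conjI)
    fix S f x assume S: "finite S" "card S < card {1..?k}" and f: "f \<in> fi_hom S {1..?k}"
      and x: "x \<in> carrier (V S)"
    show "F S {1..?k} f x \<in> carrier (V {1..?k})" by (rule F_closed[OF S(1) _ f x]) simp
    let ?c = "compose S g f"
    have c: "?c \<in> fi_hom S T" by (rule fi_compose_in[OF f g])
    \<comment> \<open>A map from a set smaller than \<open>T\<close> misses some \<open>t\<close>,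
      and hence factors through \<open>T - {t}\<close>.\<close>
    have "card (?c ` S) \<le> card S" by (rule card_image_le[OF S(1)])
    then have "\<not> T \<subseteq> ?c ` S" using S card_mono[of "?c ` S" T] by auto
    then obtain t where t: "t \<in> T" "t \<notin> ?c ` S" by blast
    then have c': "?c \<in> fi_hom S (T - {t})" using c by (auto simp: fi_hom_def PiE_def Pi_iff)
    have "F {1..?k} U g (F S {1..?k} f x) = F S U ?c x"
      using map_comp[OF S(1) _ U f gU x] by simp
    moreover have "F S U ?c x \<in> sub_image V F (T - {t}) U"
      by (rule F_in_sub_image[OF S(1) U c' TU x])
    ultimately show "F {1..?k} U g (F S {1..?k} f x) \<in> aspan ?X" using t(1) aspan_incl[of ?X] by auto
  qed
  then have all: "F {1..?k} U g y \<in> aspan ?X" if "y \<in> carrier (V {1..?k})" for y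
    using that lower_span_eq_carrier[OF gen d] by blast
  show "sub_image V F T U \<subseteq> aspan ?X"
  proof
    fix v assume "v \<in> sub_image V F T U"
    then obtain x where x: "x \<in> carrier (V T)" "v = F T U (fi_incl T) x" unfolding sub_image_def by blast
    have "v = F {1..?k} U g (F T {1..?k} g' x)"
      unfolding x(2) gg[symmetric] using map_comp[OF fT _ U g' gU x(1)] by simp
    then show "v \<in> aspan ?X" using all F_closed[OF fT _ g' x(1)] by simp
  qed
qed

text \<open>A product over \<open>m\<close> disjoint pairs is itself one of the generators of
  \<open>I_ideal m n\<close>. The ambient set is an initial interval to match
  \<open>I_annihilates\<close>.\<close>

lemma sub_image_annihilated:
  assumes ann: "I_annihilates m V F"
  shows "swap_action.annihilated (V {1..n}) (tau {1..n}) {1..n} (\<lambda>T. sub_image V F T {1..n}) m"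
proof -
  let ?U = "{1..n}"
  note sw = swap_action[OF finite_atLeastAtMost[of 1 n]]
  show ?thesis
    unfolding swap_action.annihilated_def[OF sw] swap_action.disjoint_pairs_def[OF sw]
  proof (intro allI impI ballI)
    fix ps :: "(nat \<times> nat) list" and v
    assume len: "length ps = m"
      and ps: "distinct (map fst ps @ map snd ps) \<and> fst ` set ps \<union> snd ` set ps \<subseteq> ?U"
      and "v \<in> sub_image V F ?U ?U"
    then have v: "v \<in> carrier (V ?U)"
      using additive_subgroup.a_subset[OF sub_image_subgroup[of ?U ?U]] by auto
    have ring: "ring (zgroup_ring ?U)" by (simp add: ring_zgroup_ring)
    have zip: "zip (map fst ps) (map snd ps) = ps" by (simp add: zip_map_fst_snd)
    have J: "J_prod ?U ps \<in> zhom ?U ?U" by (rule J_prod_in) (use ps in auto)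
    let ?Js = "{J_prod ?U (zip is js) | is js.
      length is = m \<and> length js = m \<and> distinct (is @ js) \<and> set (is @ js) \<subseteq> ?U}"
    have "?Js \<subseteq> carrier (zgroup_ring ?U)"
    proof clarify
      fix xs ys assume xy: "distinct (xs @ ys)" "set (xs @ ys) \<subseteq> ?U"
      have "J_prod ?U (zip xs ys) \<in> zhom ?U ?U"
        by (rule J_prod_in) (use xy in \<open>auto dest: set_zip_leftD set_zip_rightD\<close>)
      then show "J_prod ?U (zip xs ys) \<in> carrier (zgroup_ring ?U)" by (simp add: zgroup_ring_def)
    qed
    then have sub: "?Js \<subseteq> I_ideal m n"
      unfolding I_ideal_def by (rule ring.genideal_self[OF ring])
    have "J_prod ?U (zip (map fst ps) (map snd ps)) \<in> ?Js"
      using len ps by (intro CollectI exI conjI refl) auto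
    then have "J_prod ?U ps \<in> I_ideal m n" using sub unfolding zip by blast
    then have "zact V F ?U ?U (J_prod ?U ps) v = \<zero>\<^bsub>V ?U\<^esub>"
      using ann v unfolding I_annihilates_def by blast
    \<comment> \<open>\<open>J_prod\<close> is composed with the identity combination to bring it
      into the form of \<open>zact_J_prod\<close>.\<close>
    moreover have "zact V F ?U ?U (J_prod ?U ps) v = Jact ?U ps v"
      using zact_J_prod[of ?U ?U ps "zsingle (fi_incl ?U)" v] v ps J
      by (simp add: zcomp_id_right zsingle_in fi_incl_in zact_zsingle map_id)
    ultimately show "swap_action.Jprod (V ?U) (tau ?U) ps v = \<zero>\<^bsub>V ?U\<^esub>" by (simp add: Jact_def)
  qed
qed

end

section \<open>Transfer of the kernel claim back to \<open>V_n\<close>\<close>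

theorem theoremE:
  fixes V :: "nat set \<Rightarrow> (int, 'a) module"
    and F :: "nat set \<Rightarrow> nat set \<Rightarrow> (nat \<Rightarrow> nat) \<Rightarrow> 'a \<Rightarrow> 'a"
    and K d n a :: nat
    and star :: "nat \<Rightarrow> nat"
  assumes "FI_module V F"
    and "torsion_free V F"
    and "generated_in_degree_le V F d"
    and "I_annihilates (K + 1) V F"
    and "n > K + d"
    and "a \<le> n"
    and "inj_on star {1..a}"
    and "star ` {1..a} \<inter> {1..n} = {}"
  shows "deletion_sum V F n a =
    a_kernel (V {1..n}) (V ({1..n} \<union> star ` {1..a}))
      (zact V F {1..n} ({1..n} \<union> star ` {1..a}) (J_tilde n a star))"
proof -
  interpret FI_module V F by fact
  let ?N = "{1..n}" and ?T = "{1..n} \<union> star ` {1..a}"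
  \<comment> \<open>\<open>2 * n + 1\<close> is the least size meeting the strict bound
    \<open>2 * card N < card U\<close>; it also contains all partners \<open>n + k\<close>.\<close>
  define L where "L = {1..2 * n + 1}"
  let ?V = "\<lambda>T. sub_image V F T L"
  \<comment> \<open>Relabels each \<open>star k\<close> as \<open>n + k\<close> and fixes
    \<open>?N\<close>, which embeds \<open>?T\<close> in the interval \<open>L\<close>.\<close>
  define e where "e = (\<lambda>x\<in>?T. if x \<in> ?N then x else n + inv_into {1..a} star x)"
  define ps where "ps = map (\<lambda>k. (star k, k)) [1..<Suc a]"
  \<comment> \<open>The image of \<open>ps\<close> under \<open>e\<close>, with the entries of each
    pair exchanged so that first entries lie in \<open>?N\<close>.\<close>
  define qs where "qs = map (\<lambda>k. (k, n + k)) [1..<Suc a]"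
  have fT: "finite ?T" and NT: "?N \<subseteq> ?T" and fL: "finite L" and NU: "?N \<subseteq> L"
    by (auto simp: L_def)
  note fin = finite_atLeastAtMost[of "1::nat"]
  interpret U: swap_action "V L" "tau L" L by (rule swap_action[OF fL])
  have e_star: "e (star k) = n + k" if "k \<in> {1..a}" for k
  proof -
    have "star k \<in> star ` {1..a}" using that by blast
    then have "star k \<in> ?T" "star k \<notin> ?N" using assms(8) by blast+
    then show ?thesis unfolding e_def using inv_into_f_f[OF assms(7) that] by auto
  qed
  have e_N: "e k = k" if "k \<in> ?N" for k using that by (simp add: e_def)
  have "inj_on e ?T"
    using e_star e_N by (auto simp: inj_on_def ball_Un)
  moreover have "e \<in> ?T \<rightarrow>\<^sub>E L"
  proof (rule PiE_I)
    fix x assume "x \<in> ?T"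
    then show "e x \<in> L" using e_star e_N assms(6) by (auto simp: L_def)
  qed (auto simp: e_def)
  ultimately have e: "e \<in> fi_hom ?T L" by (simp add: fi_hom_def)
  have e_incl: "compose ?N e (fi_incl ?N) = fi_incl ?N"
    by (auto simp: compose_def fi_incl_def fun_eq_iff e_def)
  interpret h: abelian_group_hom "V ?N" "V L" "F ?N L (fi_incl ?N)"
    by (rule F_hom[OF fin fL fi_incl_in[OF NU]])
  interpret g: abelian_group_hom "V ?T" "V L" "F ?T L e" by (rule F_hom[OF fT fL e])
  have inj_h: "inj_on (F ?N L (fi_incl ?N)) (carrier (V ?N))"
    and inj_g: "inj_on (F ?T L e) (carrier (V ?T))"
    using assms(2) fi_incl_in[OF NU] e fT fL fin unfolding torsion_free_def by blast+
  have ps: "fst ` set ps \<union> snd ` set ps \<subseteq> ?T" using assms(6) by (auto simp: ps_def)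
  have set_qs: "fst ` set qs = {1..a}" "snd ` set qs = (+) n ` {1..a}"
    unfolding qs_def set_map set_upt image_image atLeastLessThanSuc_atLeastAtMost fst_conv snd_conv
    by (rule image_ident, rule refl)
  have qs: "U.disjoint_pairs L qs" "snd ` set qs \<subseteq> L - ?N" "fst ` set qs \<subseteq> ?N"
    using assms(6) unfolding U.disjoint_pairs_def set_qs by (auto simp: L_def qs_def distinct_map comp_def inj_on_def)
  \<comment> \<open>Torsion-freeness makes the map induced by \<open>e\<close> injective, so
    vanishing in \<open>V ?T\<close> can be tested in \<open>V L\<close>.\<close>
  have kernel: "zact V F ?N ?T (J_tilde n a star) v = \<zero>\<^bsub>V ?T\<^esub> \<longleftrightarrow>
      U.Jprod qs (F ?N L (fi_incl ?N) v) = \<zero>\<^bsub>V L\<^esub>" if v: "v \<in> carrier (V ?N)" for v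
  proof -
    let ?w = "F ?N ?T (fi_incl ?N) v"
    have w: "?w \<in> carrier (V ?T)" by (rule F_closed[OF fin fT fi_incl_in[OF NT] v])
    have "zact V F ?N ?T (J_tilde n a star) v = Jact ?T ps (zact V F ?N ?T (zsingle (fi_incl ?N)) v)"
      unfolding J_tilde_def Let_def ps_def[symmetric]
      by (rule zact_J_prod[OF fin fT ps zsingle_in[OF fi_incl_in[OF NT]] v])
    then have z: "zact V F ?N ?T (J_tilde n a star) v = Jact ?T ps ?w"
      by (simp only: zact_zsingle[OF fin fT fi_incl_in[OF NT] v])
    have map: "map (map_prod e e) ps = map prod.swap qs"
      using e_star e_N assms(6) by (auto simp: ps_def qs_def)
    have "F ?T L e (Jact ?T ps ?w) = Jact L (map (map_prod e e) ps) (F ?T L e ?w)"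
      by (rule F_Jact[OF fT fL e ps w])
    also have "F ?T L e ?w = F ?N L (fi_incl ?N) v"
      using map_comp[OF fin fT fL fi_incl_in[OF NT] e v] e_incl by simp
    also have "Jact L (map (map_prod e e) ps) \<dots> = U.Jprod qs \<dots>"
      unfolding map Jact_def using qs(1) by (intro U.Jprod_swap) (simp add: U.disjoint_pairs_def)
    finally have eq: "F ?T L e (Jact ?T ps ?w) = U.Jprod qs (F ?N L (fi_incl ?N) v)" .
    have "Jact ?T ps ?w \<in> carrier (V ?T)" by (rule Jact_closed[OF fT ps w])
    then have "Jact ?T ps ?w = \<zero>\<^bsub>V ?T\<^esub> \<longleftrightarrow> F ?T L e (Jact ?T ps ?w) = F ?T L e \<zero>\<^bsub>V ?T\<^esub>"
      using inj_on_eq_iff[OF inj_g] by blast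
    then show ?thesis using z eq g.hom_zero by simp
  qed
  note sys = sub_image_swap_system[OF fL]
  define X where "X = (\<Union>k\<in>{1..a}. sub_image V F (?N - {k}) ?N)"
  have X: "X \<subseteq> carrier (V ?N)"
    unfolding X_def by (intro UN_least additive_subgroup.a_subset sub_image_subgroup) auto
  have "deletion_sum V F n a = h.G.aspan (\<Union>(set (map (\<lambda>k. sub_image V F (?N - {k}) ?N) [1..<Suc a])))"
    unfolding deletion_sum_def
    by (rule h.G.foldr_set_add) (auto intro!: sub_image_subgroup)
  also have "\<Union>(set (map (\<lambda>k. sub_image V F (?N - {k}) ?N) [1..<Suc a])) = X"
    unfolding X_def set_map set_upt atLeastLessThanSuc_atLeastAtMost ..
  finally have del: "deletion_sum V F n a = h.G.aspan X" .
  \<comment> \<open>Composing inclusions identifies the summands inside \<open>V ?N\<close> with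
    those of the system inside \<open>V L\<close>.\<close>
  have img: "F ?N L (fi_incl ?N) ` sub_image V F (?N - {k}) ?N = ?V (?N - {k})" for k
  proof -
    have "F ?N L (fi_incl ?N) (F (?N - {k}) ?N (fi_incl (?N - {k})) x) =
        F (?N - {k}) L (fi_incl (?N - {k})) x" if x: "x \<in> carrier (V (?N - {k}))" for x
    proof -
      have i: "fi_incl (?N - {k}) \<in> fi_hom (?N - {k}) ?N" by (rule fi_incl_in) blast
      have "compose (?N - {k}) (fi_incl ?N) (fi_incl (?N - {k})) = fi_incl (?N - {k})"
        by (rule fi_compose_id_left[OF i])
      then show ?thesis
        using map_comp[OF _ fin fL i fi_incl_in[OF NU] x] by simp
    qed
    then show ?thesis unfolding sub_image_def image_image by (intro image_cong refl)
  qed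
  have VN: "F ?N L (fi_incl ?N) v \<in> ?V ?N" if "v \<in> carrier (V ?N)" for v
    using that by (simp add: sub_image_def)
  have main: "v \<in> h.G.aspan X \<longleftrightarrow> U.Jprod qs (F ?N L (fi_incl ?N) v) = \<zero>\<^bsub>V L\<^esub>"
    if v: "v \<in> carrier (V ?N)" for v
  proof
    have "X \<subseteq> {x \<in> carrier (V ?N). F ?N L (fi_incl ?N) x \<in> U.del_span ?V ?N {1..a}}"
    proof (intro subsetI CollectI conjI)
      fix x assume x: "x \<in> X"
      then show "x \<in> carrier (V ?N)" using X by blast
      obtain k where "k \<in> {1..a}" "F ?N L (fi_incl ?N) x \<in> ?V (?N - {k})"
        using x img unfolding X_def by blast
      then show "F ?N L (fi_incl ?N) x \<in> U.del_span ?V ?N {1..a}"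
        using U.del_span_incl[of k "{1..a}" ?V ?N] by blast
    qed
    then have le: "h.G.aspan X \<subseteq> {x \<in> carrier (V ?N). F ?N L (fi_incl ?N) x \<in> U.del_span ?V ?N {1..a}}"
      by (rule h.G.aspan_least[OF h.additive_subgroup_preimage[OF U.del_span_subgroup[OF sys NU]]])
    assume "v \<in> h.G.aspan X"
    then have "F ?N L (fi_incl ?N) v \<in> U.del_span ?V ?N (fst ` set qs)"
      using le unfolding set_qs by blast
    then show "U.Jprod qs (F ?N L (fi_incl ?N) v) = \<zero>\<^bsub>V L\<^esub>"
      by (rule U.Jprod_vanish[OF sys NU qs(1,3,2)])
  next
    assume J: "U.Jprod qs (F ?N L (fi_incl ?N) v) = \<zero>\<^bsub>V L\<^esub>"
    have "F ?N L (fi_incl ?N) v \<in> U.del_span ?V ?N (fst ` set qs)"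
    proof (rule U.kernel_spannedD[OF U.kernel_spanned sys sub_image_generated[OF fL assms(3)]
          _ NU _ _ qs(1,3,2) VN[OF v] J])
      show "U.annihilated L ?V (Suc K)" using sub_image_annihilated[OF assms(4)] by (simp add: L_def)
    qed (use assms(5) in \<open>auto simp: L_def\<close>)
    also have "U.del_span ?V ?N (fst ` set qs) = U.aspan (F ?N L (fi_incl ?N) ` X)"
      unfolding U.del_span_def set_qs X_def image_UN img ..
    also have "\<dots> \<subseteq> F ?N L (fi_incl ?N) ` h.G.aspan X"
      by (rule U.aspan_least[OF h.additive_subgroup_image[OF h.G.aspan_subgroup[OF X]]])
        (intro image_mono h.G.aspan_incl)
    finally obtain y where y: "y \<in> h.G.aspan X" "F ?N L (fi_incl ?N) v = F ?N L (fi_incl ?N) y" by blast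
    then have "y \<in> carrier (V ?N)"
      using additive_subgroup.a_subset[OF h.G.aspan_subgroup[OF X]] by blast
    \<comment> \<open>Membership in the span was obtained only after mapping to \<open>V L\<close>;
      injectivity of the inclusion map brings it back to \<open>V ?N\<close>.\<close>
    then have "v = y" using inj_onD[OF inj_h y(2) v] by blast
    then show "v \<in> h.G.aspan X" using y(1) by simp
  qed
  have "h.G.aspan X \<subseteq> carrier (V ?N)"
    by (rule additive_subgroup.a_subset[OF h.G.aspan_subgroup[OF X]])
  then show ?thesis
    unfolding del a_kernel_def' using main kernel by blast
qed

end
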